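(* Let $\Lambda\in X_Q$ be a generic Taylor--Socolar tiling with $\xi(\Lambda)={\bf q}=(q_1,q_1+q_2,\dots,q_1+\cdots+q_k,\dots)\in\overline Q$. Let $Q({\bf q})^{wh}$ (resp. $Q({\bf q})^{gr}$) be the set of $x\in Q$ whose tile in $\Lambda$ is white (resp. gray), and let $\overline{Q({\bf q})^{wh}},\overline{Q({\bf q})^{gr}}$ be their closures in $\overline Q$. Then each of these closures is the closure of a union of clopen sets of the form $x+2^k\overline Q$ ($x\in Q$, $k\ge 0$), and $$Q({\bf q})^{wh}=\curlywedge\bigl(\overline{Q({\bf q})^{wh}}\bigr),\qquad Q({\bf q})^{gr}=\curlywedge\bigl(\overline{Q({\bf q})^{gr}}\bigr),\qquad Q=\curlywedge\bigl(\overline{Q({\bf q})^{wh}}\bigr)\cup\curlywedge\bigl(\overline{Q({\bf q})^{gr}}\bigr).$$ Thus $Q({\bf q})^{wh}$ and $Q({\bf q})^{gr}$ are regular model sets.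
   Context: Lattices. $a_1=(1,0)$, $a_2=(-\tfrac12,\tfrac{\sqrt3}2)$, $Q=\mathbb Za_1+\mathbb Za_2\subset\mathbb R^2$, $w_1=\tfrac23a_1+\tfrac13a_2$, $w_2=\tfrac13a_1+\tfrac23a_2$, $\Omega=\{\pm w_1,\pm w_2,\pm(w_2-w_1)\}$. $\overline Q$ is the (compact) completion of $Q$ for the topology with neighborhood basis $2^kQ$ of $0$; its elements are compatible sequences $(v_1,v_2,\dots)$, $v_k=q_1+\dots+q_k$, $q_k\in2^{k-1}Q$ (taken modulo $2^kQ$). Model sets. The cut and project scheme is $\mathbb R^2\leftarrow\mathbb R^2\times\overline Q\to\overline Q$ with lattice $\{(x,x):x\in Q\}$ ($x^\star$ is $x\in Q$ viewed in $\overline Q$). For $W\subset\overline Q$ put $\curlywedge(W)=\{x\in Q: x^\star\in W\}$. If $W^\circ\subset W\subset\overline{W^\circ}=\overline W$ with $\overline W$ compact, $\curlywedge(W)$ is a model set; it is regular if moreover $\partial W=\overline W\setminus W^\circ$ has Haar measure $0$. Triangulations. For ${\bf q}=\lim v_k\in\overline Q$ ($v_0=0$), $\mathcal T({\bf q})$ is the family of triangulations of the plane, one for each $k\ge0$, by equilateral triangles of side $2^k$ with vertex set $v_k+2^kQ$ (triangles, and edges, of level $k$). An a-line is a line through a point of $Q$ in one of the directions $a_1,a_2,a_1+a_2$; its level is the supremum of the $k$ such that it contains a level-$k$ edge. A w-line is a line through a point of $Q$ in one of the directions $w_1,w_2,w_2-w_1$; its level is the supremum of the $k$ such that it contains a centroid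 of a level-$k$ triangle. ${\bf q}$ is generic if all a-lines and all w-lines have finite level; a tiling $\Lambda$ is generic if $\xi(\Lambda)$ is. Tiles and matching rules. The hexagon $H_x$ at $x\in Q$ is the regular hexagon with center $x$ and vertices $x+w$, $w\in\Omega$. A marked tile at $x$ is given by: a stripe direction (one of the lines $\mathbb Ra_1,\mathbb Ra_2,\mathbb R(a_1+a_2)$); a black stripe across $H_x$ parallel to that direction and displaced from $x$ by a fixed small $\epsilon>0$ ($0<\epsilon\le1/4$) to one of the two sides; two further black V-shaped lines, one on each side, each joining the two hexagon edges adjacent to the vertex of $H_x$ lying on that side on the long diagonal perpendicular to the stripe direction, with legs perpendicular to these edges and displaced by $\epsilon$ from the edge midpoints towards that vertex; the long diagonal at angle $\pi/6$ clockwise from the stripe direction colored red, the one at $\pi/6$ counterclockwise colored blue, and the one perpendicular to the stripe direction colored half red and half blue (either way around, split at $x$). The tile is white if the displaced stripe crosses the red half of the split diagonal and gray if it crosses the blue half. $X_Q$ is the set of all choices of a marked tile at every $x\in Q$ such that: (R1) on each common edge of two adjacent hexagons the black lines of the two tiles meet (same displacement from the edge midpoint); (R2) for all $x\in Q$, $w\in\Omega$, the color at the end $x+w$ of the diagonal of $H_x$ and the color at the end $x+2w$ of the diagonal of $H_{x+3w}$ are opposite. The map $\xi$. For each $\Lambda\in X_Q$ there is a unique ${\bf q}=\xi(\Lambda)\in\overline Q$ such that for each $x\in Q$ (other than a point lying on three a-lines of infinite level) the stripe direction at $x$ is that of the a-line through $x$ of strictly largest level in $\mathcal T({\bf q})$,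 and, if this level is a finite number $k$, the stripe is displaced towards the centroid of the unique level-$(k+1)$ triangle having as a midsegment the level-$k$ edge that contains $x$. *)

theory Defs
  imports "HOL-Probability.Probability"
begin

text \<open>The plane is the type \<open>complex\<close>; rotation by the angle \<open>t\<close> (counterclockwise)
  is multiplication by \<open>cis t\<close>, and \<open>sgn z\<close> is the unit vector in direction \<open>z\<close>.\<close>

definition a\<^sub>1 :: complex where "a\<^sub>1 = Complex 1 0"
definition a\<^sub>2 :: complex where "a\<^sub>2 = Complex (- 1 / 2) (sqrt 3 / 2)"

definition Qlat :: "complex set" where
  "Qlat = {of_int m * a\<^sub>1 + of_int n * a\<^sub>2 | m n. True}"

definition w\<^sub>1 :: complex where "w\<^sub>1 = 2 / 3 * a\<^sub>1 + 1 / 3 * a\<^sub>2"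
definition w\<^sub>2 :: complex where "w\<^sub>2 = 1 / 3 * a\<^sub>1 + 2 / 3 * a\<^sub>2"

definition Omega :: "complex set" where
  "Omega = {w\<^sub>1, - w\<^sub>1, w\<^sub>2, - w\<^sub>2, w\<^sub>2 - w\<^sub>1, - (w\<^sub>2 - w\<^sub>1)}"

definition a_dirs :: "complex set" where "a_dirs = {a\<^sub>1, a\<^sub>2, a\<^sub>1 + a\<^sub>2}"
definition w_dirs :: "complex set" where "w_dirs = {w\<^sub>1, w\<^sub>2, w\<^sub>2 - w\<^sub>1}"

definition Qcoset :: "nat \<Rightarrow> complex \<Rightarrow> complex set" where
  "Qcoset k x = {x + 2 ^ k * z | z. z \<in> Qlat}"

lemma a2_Im [simp]: "Im a\<^sub>2 = sqrt 3 / 2" and a1_Im [simp]: "Im a\<^sub>1 = 0"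
  and a2_Re [simp]: "Re a\<^sub>2 = - 1 / 2" and a1_Re [simp]: "Re a\<^sub>1 = 1"
  by (simp_all add: a\<^sub>1_def a\<^sub>2_def)

lemma Qlat_0 [simp]: "0 \<in> Qlat"
  unfolding Qlat_def by (auto intro!: exI[of _ 0])

lemma Qlat_add: "x \<in> Qlat \<Longrightarrow> y \<in> Qlat \<Longrightarrow> x + y \<in> Qlat"
proof -
  assume "x \<in> Qlat" "y \<in> Qlat"
  then obtain m n m' n' where "x = of_int m * a\<^sub>1 + of_int n * a\<^sub>2" "y = of_int m' * a\<^sub>1 + of_int n' * a\<^sub>2"
    by (auto simp: Qlat_def)
  hence "x + y = of_int (m + m') * a\<^sub>1 + of_int (n + n') * a\<^sub>2" by (simp add: algebra_simps)
  thus ?thesis unfolding Qlat_def by blast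
qed

lemma Qlat_uminus: "x \<in> Qlat \<Longrightarrow> - x \<in> Qlat"
proof -
  assume "x \<in> Qlat"
  then obtain m n where "x = of_int m * a\<^sub>1 + of_int n * a\<^sub>2" by (auto simp: Qlat_def)
  hence "- x = of_int (- m) * a\<^sub>1 + of_int (- n) * a\<^sub>2" by (simp add: algebra_simps)
  thus ?thesis unfolding Qlat_def by blast
qed

lemma Qlat_diff: "x \<in> Qlat \<Longrightarrow> y \<in> Qlat \<Longrightarrow> x - y \<in> Qlat"
  using Qlat_add[of x "- y"] Qlat_uminus[of y] by simp

lemma Qlat_pow2: "x \<in> Qlat \<Longrightarrow> 2 ^ k * x \<in> Qlat"
proof (induction k)
  case (Suc k)
  then have "2 ^ k * x + 2 ^ k * x \<in> Qlat" by (intro Qlat_add) auto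
  thus ?case by (simp add: algebra_simps)
qed simp

lemma Qcoset_iff: "y \<in> Qcoset k x \<longleftrightarrow> (\<exists>z\<in>Qlat. y - x = 2 ^ k * z)"
  by (auto simp: Qcoset_def algebra_simps)

lemma Qcoset_self [simp]: "x \<in> Qcoset k x"
  by (auto simp: Qcoset_iff intro!: bexI[of _ 0])

lemma Qcoset_sym: "y \<in> Qcoset k x \<Longrightarrow> x \<in> Qcoset k y"
proof -
  assume "y \<in> Qcoset k x"
  then obtain z where "z \<in> Qlat" "y - x = 2 ^ k * z" by (auto simp: Qcoset_iff)
  hence "- z \<in> Qlat" "x - y = 2 ^ k * (- z)" by (auto simp: Qlat_uminus algebra_simps)
  thus ?thesis unfolding Qcoset_iff by blast
qed

lemma Qcoset_add_mem: "u \<in> Qcoset k x \<Longrightarrow> v \<in> Qcoset k y \<Longrightarrow> u + v \<in> Qcoset k (x + y)"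
proof -
  assume "u \<in> Qcoset k x" "v \<in> Qcoset k y"
  then obtain z z' where "z \<in> Qlat" "u - x = 2 ^ k * z" "z' \<in> Qlat" "v - y = 2 ^ k * z'"
    by (auto simp: Qcoset_iff)
  hence "z + z' \<in> Qlat" "u + v - (x + y) = 2 ^ k * (z + z')"
    by (auto intro: Qlat_add simp: algebra_simps)
  thus ?thesis unfolding Qcoset_iff by blast
qed

lemma Qcoset_trans: "z \<in> Qcoset k y \<Longrightarrow> y \<in> Qcoset k x \<Longrightarrow> z \<in> Qcoset k x"
proof -
  assume "z \<in> Qcoset k y" "y \<in> Qcoset k x"
  then obtain u v where "u \<in> Qlat" "z - y = 2 ^ k * u" "v \<in> Qlat" "y - x = 2 ^ k * v"
    by (auto simp: Qcoset_iff)
  hence "u + v \<in> Qlat" "z - x = 2 ^ k * (u + v)"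
    by (auto intro: Qlat_add simp: algebra_simps)
  thus ?thesis unfolding Qcoset_iff by blast
qed

lemma Qcoset_eq_iff: "Qcoset k x = Qcoset k y \<longleftrightarrow> x \<in> Qcoset k y"
  using Qcoset_self Qcoset_sym Qcoset_trans by blast

lemma Qcoset_mono: "j \<le> k \<Longrightarrow> Qcoset k x \<subseteq> Qcoset j x"
proof
  fix y assume "j \<le> k" "y \<in> Qcoset k x"
  then obtain z where z: "z \<in> Qlat" "y - x = 2 ^ k * z" by (auto simp: Qcoset_iff)
  have "2 ^ k = (2 ^ j * 2 ^ (k - j) :: complex)" using \<open>j \<le> k\<close> by (simp flip: power_add)
  with z have "y - x = 2 ^ j * (2 ^ (k - j) * z)" by simp
  with z(1) show "y \<in> Qcoset j x" by (auto simp: Qcoset_iff intro: Qlat_pow2)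
qed

lemma Qcoset_Suc: "Qcoset (Suc k) x \<subseteq> Qcoset k x"
  by (rule Qcoset_mono) simp

lemma Qcoset_plus: "{u + v | u v. u \<in> Qcoset k x \<and> v \<in> Qcoset k y} = Qcoset k (x + y)"
proof (intro equalityI subsetI)
  fix z assume "z \<in> Qcoset k (x + y)"
  hence "z - y \<in> Qcoset k x" by (auto simp: Qcoset_iff algebra_simps)
  moreover have "z = (z - y) + y" by simp
  ultimately show "z \<in> {u + v | u v. u \<in> Qcoset k x \<and> v \<in> Qcoset k y}"
    using Qcoset_self by blast
qed (auto intro: Qcoset_add_mem)

lemma Qcoset_minus: "uminus ` Qcoset k x = Qcoset k (- x)"
proof -
  have *: "- y \<in> Qcoset k (- x)" if "y \<in> Qcoset k x" for x y
  proof -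
    from that obtain z where "z \<in> Qlat" "y - x = 2 ^ k * z" by (auto simp: Qcoset_iff)
    hence "- z \<in> Qlat" "- y - (- x) = 2 ^ k * (- z)" by (auto simp: Qlat_uminus algebra_simps)
    thus ?thesis unfolding Qcoset_iff by blast
  qed
  show ?thesis
  proof (intro equalityI subsetI)
    fix z assume "z \<in> Qcoset k (- x)"
    hence "- z \<in> Qcoset k x" using *[of z "- x"] by simp
    thus "z \<in> uminus ` Qcoset k x" by (metis imageI minus_minus)
  qed (auto intro: *)
qed

text \<open>A compatible sequence \<open>(v\<^sub>1, v\<^sub>2, \<dots>)\<close>, with \<open>v\<^sub>k\<close> taken modulo \<open>2\<^sup>k Q\<close>, is the decreasing
  sequence of cosets \<open>v\<^sub>k + 2\<^sup>k Q\<close>; the entry with index 0 is \<open>Q\<close> itself (\<open>v\<^sub>0 = 0\<close>).\<close>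

definition compatible :: "(nat \<Rightarrow> complex set) \<Rightarrow> bool" where
  "compatible c \<longleftrightarrow> (\<forall>k. \<exists>v\<in>Qlat. c k = Qcoset k v) \<and> (\<forall>k. c (Suc k) \<subseteq> c k)"

lemma compatible_const: "x \<in> Qlat \<Longrightarrow> compatible (\<lambda>k. Qcoset k x)"
  unfolding compatible_def using Qcoset_Suc by blast

lemma compatible_plus:
  assumes "compatible c" "compatible d"
  shows "compatible (\<lambda>k. {u + v | u v. u \<in> c k \<and> v \<in> d k})"
  unfolding compatible_def
proof (intro conjI allI)
  fix k
  obtain x y where *: "x \<in> Qlat" "y \<in> Qlat" "c k = Qcoset k x" "d k = Qcoset k y"
    using assms unfolding compatible_def by meson
  show "\<exists>v\<in>Qlat. {u + v | u v. u \<in> c k \<and> v \<in> d k} = Qcoset k v"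
    by (rule bexI[of _ "x + y"]) (simp_all add: * Qcoset_plus Qlat_add)
  have "c (Suc k) \<subseteq> c k" "d (Suc k) \<subseteq> d k" using assms by (simp_all add: compatible_def)
  thus "{u + v | u v. u \<in> c (Suc k) \<and> v \<in> d (Suc k)} \<subseteq> {u + v | u v. u \<in> c k \<and> v \<in> d k}"
    by blast
qed

lemma compatible_uminus:
  assumes "compatible c"
  shows "compatible (\<lambda>k. uminus ` c k)"
  unfolding compatible_def
proof (intro conjI allI)
  fix k
  obtain x where *: "x \<in> Qlat" "c k = Qcoset k x"
    using assms unfolding compatible_def by meson
  show "\<exists>v\<in>Qlat. uminus ` c k = Qcoset k v"
    by (rule bexI[of _ "- x"]) (simp_all add: * Qcoset_minus Qlat_uminus)
  have "c (Suc k) \<subseteq> c k" using assms by (simp add: compatible_def)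
  thus "uminus ` c (Suc k) \<subseteq> uminus ` c k" by (rule image_mono)
qed

typedef qbar = "{c. compatible c}"
  morphisms qcomp Abs_qbar
  using compatible_const[OF Qlat_0] by blast

setup_lifting type_definition_qbar

text \<open>\<open>star x\<close> is the lattice point \<open>x\<close> viewed in the completion.  The value for
  \<open>x \<notin> Qlat\<close> is irrelevant.\<close>

lift_definition star :: "complex \<Rightarrow> qbar" is "\<lambda>x k. Qcoset k (if x \<in> Qlat then x else 0)"
  by (simp add: compatible_const)

lemma qcomp_ex: "\<exists>v\<in>Qlat. qcomp y k = Qcoset k v"
  using qcomp[of y] by (simp add: compatible_def)

lemma qcomp_star: "x \<in> Qlat \<Longrightarrow> qcomp (star x) k = Qcoset k x"
  by (simp add: star.rep_eq)

lemma qcomp_Suc: "qcomp y (Suc k) \<subseteq> qcomp y k"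
  using qcomp[of y] by (simp add: compatible_def)

lemma qcomp_antimono: "j \<le> k \<Longrightarrow> qcomp y k \<subseteq> qcomp y j"
  by (rule lift_Suc_antimono_le[of "qcomp y", OF qcomp_Suc])

lemma qcomp_eq: "x \<in> qcomp y k \<Longrightarrow> qcomp y k = Qcoset k x"
  using qcomp_ex[of y k] Qcoset_eq_iff by metis

lemma qbar_eqI: "(\<And>k. qcomp x k = qcomp y k) \<Longrightarrow> x = y"
  by (metis ext qcomp_inject)

lemma qcomp_eq_mono: "j \<le> k \<Longrightarrow> qcomp x k = qcomp y k \<Longrightarrow> qcomp x j = qcomp y j"
  by (metis Qcoset_self qcomp_antimono qcomp_eq qcomp_ex subsetD)

instantiation qbar :: ab_group_add
begin

lift_definition zero_qbar :: qbar is "\<lambda>k. Qcoset k 0"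
  by (simp add: compatible_const)

lift_definition plus_qbar :: "qbar \<Rightarrow> qbar \<Rightarrow> qbar" is
  "\<lambda>c d k. {u + v | u v. u \<in> c k \<and> v \<in> d k}"
  by (simp add: compatible_plus)

lift_definition uminus_qbar :: "qbar \<Rightarrow> qbar" is "\<lambda>c k. uminus ` c k"
  by (simp add: compatible_uminus)

definition minus_qbar :: "qbar \<Rightarrow> qbar \<Rightarrow> qbar" where "minus_qbar x y = x + (- y)"

lemma qcomp_zero: "qcomp 0 k = Qcoset k 0"
  by (simp add: zero_qbar.rep_eq)

lemma qcomp_plus:
  "qcomp x k = Qcoset k u \<Longrightarrow> qcomp y k = Qcoset k v \<Longrightarrow> qcomp (x + y) k = Qcoset k (u + v)"
  by (simp add: plus_qbar.rep_eq Qcoset_plus)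

lemma qcomp_uminus: "qcomp x k = Qcoset k u \<Longrightarrow> qcomp (- x) k = Qcoset k (- u)"
  by (simp add: uminus_qbar.rep_eq Qcoset_minus)

instance
proof
  fix x y z :: qbar
  show "x + y + z = x + (y + z)"
  proof (rule qbar_eqI)
    fix k
    obtain a b c where *: "qcomp x k = Qcoset k a" "qcomp y k = Qcoset k b" "qcomp z k = Qcoset k c"
      using qcomp_ex[of x k] qcomp_ex[of y k] qcomp_ex[of z k] by blast
    show "qcomp (x + y + z) k = qcomp (x + (y + z)) k"
      using qcomp_plus[OF qcomp_plus[OF *(1,2)] *(3)] qcomp_plus[OF *(1) qcomp_plus[OF *(2,3)]]
      by (simp add: add.assoc)
  qed
  show "x + y = y + x"
  proof (rule qbar_eqI)
    fix k
    obtain a b where *: "qcomp x k = Qcoset k a" "qcomp y k = Qcoset k b"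
      using qcomp_ex[of x k] qcomp_ex[of y k] by blast
    show "qcomp (x + y) k = qcomp (y + x) k"
      using qcomp_plus[OF *] qcomp_plus[OF *(2,1)] by (simp add: add.commute)
  qed
  show "0 + x = x"
  proof (rule qbar_eqI)
    fix k
    obtain a where *: "qcomp x k = Qcoset k a" using qcomp_ex[of x k] by blast
    show "qcomp (0 + x) k = qcomp x k"
      using qcomp_plus[OF qcomp_zero *] * by simp
  qed
  show "- x + x = 0"
  proof (rule qbar_eqI)
    fix k
    obtain a where *: "qcomp x k = Qcoset k a" using qcomp_ex[of x k] by blast
    show "qcomp (- x + x) k = qcomp 0 k"
      using qcomp_plus[OF qcomp_uminus[OF *] *] by (simp add: qcomp_zero)
  qed
  show "x - y = x + - y" by (rule minus_qbar_def)
qed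

end

instantiation qbar :: t2_space
begin

definition open_qbar :: "qbar set \<Rightarrow> bool" where
  "open_qbar U \<longleftrightarrow> (\<forall>y\<in>U. \<exists>k. {z. qcomp z k = qcomp y k} \<subseteq> U)"

lemma open_qbarD: "open U \<Longrightarrow> y \<in> U \<Longrightarrow> \<exists>k. {z. qcomp z k = qcomp y k} \<subseteq> U"
  unfolding open_qbar_def by (rule bspec)

instance
proof
  show "open (UNIV :: qbar set)" by (simp add: open_qbar_def)
  show "open (S \<inter> T)" if ST: "open S" "open T" for S T :: "qbar set"
    unfolding open_qbar_def
  proof
    fix y assume "y \<in> S \<inter> T"
    hence "y \<in> S" "y \<in> T" by simp_all
    from open_qbarD[OF ST(1) \<open>y \<in> S\<close>] obtain j where "{z. qcomp z j = qcomp y j} \<subseteq> S"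
      by (rule exE)
    moreover from open_qbarD[OF ST(2) \<open>y \<in> T\<close>] obtain k where "{z. qcomp z k = qcomp y k} \<subseteq> T"
      by (rule exE)
    moreover have "{z. qcomp z (max j k) = qcomp y (max j k)} \<subseteq> {z. qcomp z j = qcomp y j}"
      by (intro Collect_mono impI, erule qcomp_eq_mono[rotated]) simp
    moreover have "{z. qcomp z (max j k) = qcomp y (max j k)} \<subseteq> {z. qcomp z k = qcomp y k}"
      by (intro Collect_mono impI, erule qcomp_eq_mono[rotated]) simp
    ultimately have "{z. qcomp z (max j k) = qcomp y (max j k)} \<subseteq> S \<inter> T"
      by (iprover intro: Int_greatest elim: subset_trans)
    thus "\<exists>k. {z. qcomp z k = qcomp y k} \<subseteq> S \<inter> T" ..
  qed
  show "open (\<Union>K)" if K: "\<forall>S\<in>K. open S" for K :: "qbar set set"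
    unfolding open_qbar_def
  proof
    fix y assume "y \<in> \<Union>K"
    then obtain S where S: "S \<in> K" "y \<in> S" by blast
    with K have "open S" by blast
    from open_qbarD[OF \<open>open S\<close> \<open>y \<in> S\<close>] obtain k where "{z. qcomp z k = qcomp y k} \<subseteq> S"
      by (rule exE)
    with S show "\<exists>k. {z. qcomp z k = qcomp y k} \<subseteq> \<Union>K" by blast
  qed
  show "\<exists>U V. open U \<and> open V \<and> x \<in> U \<and> y \<in> V \<and> U \<inter> V = {}" if "x \<noteq> y" for x y :: qbar
  proof -
    from that obtain k where k: "qcomp x k \<noteq> qcomp y k" using qbar_eqI by blast
    let ?U = "\<lambda>x. {z. qcomp z k = qcomp x k}"
    have "open (?U x)" "open (?U y)" by (auto simp: open_qbar_def)
    moreover have "x \<in> ?U x" "y \<in> ?U y" "?U x \<inter> ?U y = {}" using k by auto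
    ultimately show ?thesis by blast
  qed
qed

end

text \<open>The set \<open>x + 2\<^sup>k qbar\<close>; multiplication by \<open>2\<^sup>k\<close> is \<open>k\<close>-fold doubling.\<close>

definition basic_clopen :: "complex \<Rightarrow> nat \<Rightarrow> qbar set" where
  "basic_clopen x k = {star x + ((\<lambda>z. z + z) ^^ k) y | y. True}"

text \<open>Normalized to total mass 1, since the group in question is compact.\<close>

definition is_haar :: "'a :: {topological_space, ab_group_add} measure \<Rightarrow> bool" where
  "is_haar \<mu> \<longleftrightarrow> sets \<mu> = sets borel \<and> emeasure \<mu> UNIV = 1 \<and>
     (\<forall>g. \<forall>A\<in>sets borel. emeasure \<mu> ((+) g ` A) = emeasure \<mu> A)"

definition qcyl :: "nat \<Rightarrow> qbar \<Rightarrow> qbar set" where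
  "qcyl k y = {z. qcomp z k = qcomp y k}"

lemma qcyl_self: "y \<in> qcyl k y"
  by (simp add: qcyl_def)

lemma open_qcyl: "open (qcyl k y)"
  unfolding open_qbar_def qcyl_def by auto

lemma qcyl_eq: "z \<in> qcyl k y \<Longrightarrow> qcyl k z = qcyl k y"
  by (simp add: qcyl_def)

lemma qcyl_mono: "j \<le> k \<Longrightarrow> qcyl k y \<subseteq> qcyl j y"
  unfolding qcyl_def using qcomp_eq_mono by blast

lemma qcyl_star: "\<exists>v\<in>Qlat. qcyl k y = qcyl k (star v)"
proof -
  obtain v where "v \<in> Qlat" "qcomp y k = Qcoset k v" using qcomp_ex[of y k] by blast
  thus ?thesis by (intro bexI[of _ v]) (simp_all add: qcyl_def qcomp_star)
qed

lemma translate_qcyl: "(+) g ` qcyl k y = qcyl k (g + y)"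
proof -
  have *: "g + z \<in> qcyl k (g + y)" if "z \<in> qcyl k y" for g y z
    using that by (simp add: qcyl_def plus_qbar.rep_eq)
  have "z \<in> (+) g ` qcyl k y" if "z \<in> qcyl k (g + y)" for z
  proof -
    have "- g + z \<in> qcyl k y" using *[OF that, of "- g"] by (simp add: add.assoc [symmetric])
    thus ?thesis by (intro image_eqI[of _ _ "- g + z"]) (simp_all add: add.assoc [symmetric])
  qed
  with * show ?thesis by blast
qed

definition qcyls :: "qbar set set" where
  "qcyls = insert {} {qcyl k y | k y. True}"

lemma countable_Qlat: "countable Qlat"
proof -
  have "Qlat = (\<lambda>(m, n). of_int m * a\<^sub>1 + of_int n * a\<^sub>2) ` (UNIV :: (int \<times> int) set)"
    by (auto simp: Qlat_def image_iff)
  thus ?thesis by (metis countable_image countableI_type)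
qed

lemma countable_qcyls: "countable qcyls"
proof -
  have "qcyls \<subseteq> insert {} ((\<lambda>(k, v). qcyl k (star v)) ` (UNIV \<times> Qlat))"
  proof
    fix A assume "A \<in> qcyls"
    then consider "A = {}" | k y where "A = qcyl k y" by (auto simp: qcyls_def)
    thus "A \<in> insert {} ((\<lambda>(k, v). qcyl k (star v)) ` (UNIV \<times> Qlat))"
    proof cases
      case 2
      obtain v where "v \<in> Qlat" "qcyl k y = qcyl k (star v)" using qcyl_star by blast
      with 2 show ?thesis by (intro insertI2 image_eqI[of _ _ "(k, v)"]) auto
    qed simp
  qed
  moreover have "countable (insert {} ((\<lambda>(k, v). qcyl k (star v)) ` (UNIV \<times> Qlat)))"
    by (intro countable_insert countable_image countable_SIGMA countableI_type countable_Qlat)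
  ultimately show ?thesis by (rule countable_subset)
qed

lemma Int_stable_qcyls: "Int_stable qcyls"
proof (rule Int_stableI)
  fix A B assume AB: "A \<in> qcyls" "B \<in> qcyls"
  show "A \<inter> B \<in> qcyls"
  proof (cases "A \<inter> B = {}")
    case True thus ?thesis by (simp add: qcyls_def)
  next
    case False
    then obtain z where z: "z \<in> A" "z \<in> B" by blast
    from AB z obtain j k where *: "A = qcyl j z" "B = qcyl k z"
      using qcyl_eq unfolding qcyls_def by (smt (verit) empty_iff insert_iff mem_Collect_eq)
    have "A \<inter> B = qcyl (max j k) z"
    proof (cases "j \<le> k")
      case True thus ?thesis using * qcyl_mono[OF True, of z] by (simp add: max_def Int_absorb1)
    next
      case False
      hence "k \<le> j" by simp
      thus ?thesis using * qcyl_mono[of k j z] False by (simp add: max_def Int_absorb2)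
    qed
    thus ?thesis unfolding qcyls_def by blast
  qed
qed

lemma sets_borel_qbar: "sets (borel :: qbar measure) = sigma_sets UNIV qcyls"
proof -
  have "U \<in> sigma_sets UNIV qcyls" if U: "open U" for U :: "qbar set"
  proof -
    have "\<Union>{A \<in> qcyls. A \<subseteq> U} = U"
    proof (intro equalityI subsetI)
      fix y assume "y \<in> U"
      from open_qbarD[OF U \<open>y \<in> U\<close>] obtain k where "qcyl k y \<subseteq> U"
        unfolding qcyl_def by (rule exE)
      moreover have "qcyl k y \<in> qcyls" unfolding qcyls_def by blast
      ultimately show "y \<in> \<Union>{A \<in> qcyls. A \<subseteq> U}" using qcyl_self[of y k] by blast
    qed blast
    moreover have "\<Union>{A \<in> qcyls. A \<subseteq> U} \<in> sigma_sets UNIV qcyls"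
    proof (rule sigma_sets_UNION)
      show "countable {A \<in> qcyls. A \<subseteq> U}"
        by (rule countable_subset[OF _ countable_qcyls]) blast
    qed (rule sigma_sets.Basic, simp)
    ultimately show ?thesis by metis
  qed
  hence 1: "sigma_sets UNIV (Collect open) \<subseteq> sigma_sets UNIV qcyls"
    by (intro sigma_sets_mono) blast
  have "qcyls \<subseteq> Collect open"
    unfolding qcyls_def using open_qcyl by auto
  hence 2: "sigma_sets UNIV qcyls \<subseteq> sigma_sets UNIV (Collect open)"
    by (rule sigma_sets_mono')
  have 3: "sets (borel :: qbar measure) = sigma_sets UNIV (Collect open)"
    unfolding borel_def by (rule sets_measure_of) simp
  show ?thesis unfolding 3 using 1 2 by (rule subset_antisym)
qed

lemma borel_qbar: "(borel :: qbar measure) = sigma UNIV qcyls"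
proof -
  have "sigma_sets UNIV (Collect open) = sigma_sets UNIV qcyls"
    using sets_borel_qbar unfolding borel_def by simp
  thus ?thesis unfolding borel_def by (rule sigma_eqI[rotated 2]) simp_all
qed

lemma measure_eqI_qcyls:
  assumes "sets \<mu> = sets borel" "sets \<nu> = sets borel"
    and eq: "\<And>k y. emeasure \<mu> (qcyl k y) = emeasure \<nu> (qcyl k y)"
    and fin: "emeasure \<mu> UNIV = 1"
  shows "\<mu> = \<nu>"
proof (rule measure_eqI_generator_eq[OF Int_stable_qcyls])
  show "qcyls \<subseteq> Pow UNIV" by simp
  show "emeasure \<mu> X = emeasure \<nu> X" if "X \<in> qcyls" for X
    using that eq by (auto simp: qcyls_def)
  have 0: "qcyl 0 0 = UNIV"
  proof -
    have "qcomp z 0 = qcomp 0 0" for z :: qbar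
    proof -
      obtain v where v: "v \<in> Qlat" "qcomp z 0 = Qcoset 0 v" using qcomp_ex[of z 0] by blast
      hence "Qcoset 0 v = Qcoset 0 0" unfolding Qcoset_eq_iff Qcoset_iff by auto
      with v show ?thesis by (simp add: qcomp_zero)
    qed
    thus ?thesis by (auto simp: qcyl_def)
  qed
  show "range (\<lambda>_. qcyl 0 0) \<subseteq> qcyls" by (auto simp: qcyls_def)
  show "(\<Union>i::nat. qcyl 0 0) = UNIV" using 0 by simp
  show "emeasure \<mu> (qcyl 0 0) \<noteq> \<infinity>" using 0 fin by simp
qed (simp_all only: assms(1,2) sets_borel_qbar)

lemma finite_range_qcyl: "finite (range (qcyl k))"
proof -
  let ?f = "\<lambda>(m, n). qcyl k (star (of_int m * a\<^sub>1 + of_int n * a\<^sub>2))"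
  have "range (qcyl k) \<subseteq> ?f ` ({0..<2 ^ k} \<times> {0..<2 ^ k})"
  proof safe
    fix y
    obtain v where v: "v \<in> Qlat" "qcyl k y = qcyl k (star v)" using qcyl_star by blast
    then obtain m n where mn: "v = of_int m * a\<^sub>1 + of_int n * a\<^sub>2" by (auto simp: Qlat_def)
    define m' n' where "m' = m mod 2 ^ k" and "n' = n mod 2 ^ k"
    define v' where "v' = of_int m' * a\<^sub>1 + of_int n' * a\<^sub>2"
    define z where "z = of_int (m div 2 ^ k) * a\<^sub>1 + of_int (n div 2 ^ k) * a\<^sub>2"
    have "m = m' + 2 ^ k * (m div 2 ^ k)" "n = n' + 2 ^ k * (n div 2 ^ k)"
      by (simp_all add: m'_def n'_def)
    hence "(of_int m :: complex) = of_int m' + 2 ^ k * of_int (m div 2 ^ k)"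
      "(of_int n :: complex) = of_int n' + 2 ^ k * of_int (n div 2 ^ k)"
      by (metis of_int_add of_int_mult of_int_numeral of_int_power)+
    hence "v - v' = 2 ^ k * z" unfolding mn v'_def z_def by (simp add: algebra_simps)
    moreover have "z \<in> Qlat" "v' \<in> Qlat" unfolding z_def v'_def Qlat_def by blast+
    ultimately have "Qcoset k v = Qcoset k v'" unfolding Qcoset_eq_iff Qcoset_iff by blast
    hence "qcyl k (star v) = qcyl k (star v')"
      using v(1) \<open>v' \<in> Qlat\<close> by (simp add: qcyl_def qcomp_star)
    with v have "qcyl k y = ?f (m', n')" by (simp add: v'_def)
    moreover have "(m', n') \<in> {0..<2 ^ k} \<times> {0..<2 ^ k}" by (simp add: m'_def n'_def)
    ultimately show "qcyl k y \<in> ?f ` ({0..<2 ^ k} \<times> {0..<2 ^ k})" by (rule image_eqI)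
  qed
  thus ?thesis by (rule finite_subset) (intro finite_imageI finite_cartesian_product finite_atLeastLessThan_int)
qed

lemma is_haar_qcyl:
  assumes "is_haar \<mu>"
  shows "of_nat (card (range (qcyl k))) * emeasure \<mu> (qcyl k y) = 1"
proof -
  have sets: "qcyl k z \<in> sets \<mu>" "qcyl k z \<in> sets borel" for z
    using assms open_qcyl[of k z] by (auto simp: is_haar_def)
  have *: "emeasure \<mu> (qcyl k z) = emeasure \<mu> (qcyl k y)" for z
  proof -
    have "qcyl k z = (+) (z - y) ` qcyl k y" by (simp add: translate_qcyl)
    thus ?thesis using assms sets(2) unfolding is_haar_def by metis
  qed
  have "(\<Union>A\<in>range (qcyl k). A) = UNIV" using qcyl_self by blast
  moreover have "disjoint_family_on (\<lambda>A. A) (range (qcyl k))"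
    unfolding disjoint_family_on_def
  proof (intro ballI impI)
    fix A B assume AB: "A \<in> range (qcyl k)" "B \<in> range (qcyl k)" "A \<noteq> B"
    have False if x: "x \<in> A" "x \<in> B" for x
    proof -
      have "A = qcyl k x" "B = qcyl k x" using AB(1,2) x qcyl_eq by blast+
      with AB(3) show False by simp
    qed
    thus "A \<inter> B = {}" by blast
  qed
  moreover have "(\<lambda>A. A) ` range (qcyl k) \<subseteq> sets \<mu>" using sets by auto
  ultimately have "(\<Sum>A\<in>range (qcyl k). emeasure \<mu> A) = emeasure \<mu> UNIV"
    using sum_emeasure[of "\<lambda>A. A" "range (qcyl k)" \<mu>] finite_range_qcyl by simp
  moreover have "(\<Sum>A\<in>range (qcyl k). emeasure \<mu> A) = (\<Sum>A\<in>range (qcyl k). emeasure \<mu> (qcyl k y))"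
    by (rule sum.cong) (use * in auto)
  ultimately show ?thesis using assms by (simp add: is_haar_def)
qed

lemma is_haar_unique:
  fixes \<mu> \<nu> :: "qbar measure"
  assumes "is_haar \<mu>" "is_haar \<nu>"
  shows "\<mu> = \<nu>"
proof (rule measure_eqI_qcyls)
  fix k y
  let ?N = "of_nat (card (range (qcyl k))) :: ennreal"
  let ?a = "emeasure \<mu> (qcyl k y)" and ?b = "emeasure \<nu> (qcyl k y)"
  have ab: "?N * ?a = 1" "?N * ?b = 1"
    using is_haar_qcyl[OF assms(1)] is_haar_qcyl[OF assms(2)] by blast+
  have "?a = (?N * ?b) * ?a" unfolding ab by simp
  also have "\<dots> = (?N * ?a) * ?b" by (simp only: ac_simps)
  also have "\<dots> = ?b" unfolding ab by simp
  finally show "?a = ?b" .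
qed (use assms in \<open>simp_all add: is_haar_def\<close>)

definition digit :: "bool \<times> bool \<Rightarrow> complex" where
  "digit d = of_bool (fst d) * a\<^sub>1 + of_bool (snd d) * a\<^sub>2"

definition digit_sum :: "(nat \<Rightarrow> bool \<times> bool) \<Rightarrow> nat \<Rightarrow> complex" where
  "digit_sum d k = (\<Sum>i<k. 2 ^ i * digit (d i))"

lemma digit_in_Qlat: "digit d \<in> Qlat"
proof -
  have "digit d = of_int (of_bool (fst d)) * a\<^sub>1 + of_int (of_bool (snd d)) * a\<^sub>2"
    by (simp add: digit_def)
  thus ?thesis unfolding Qlat_def by blast
qed

lemma digit_sum_in_Qlat: "digit_sum d k \<in> Qlat"
  by (induction k) (simp_all add: digit_sum_def Qlat_add Qlat_pow2 digit_in_Qlat)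

lemma Qlat_coords:
  assumes "of_int m * a\<^sub>1 + of_int n * a\<^sub>2 = of_int m' * a\<^sub>1 + of_int n' * a\<^sub>2"
  shows "m = m' \<and> n = n'"
proof -
  have "Im (of_int m * a\<^sub>1 + of_int n * a\<^sub>2) = Im (of_int m' * a\<^sub>1 + of_int n' * a\<^sub>2)"
    "Re (of_int m * a\<^sub>1 + of_int n * a\<^sub>2) = Re (of_int m' * a\<^sub>1 + of_int n' * a\<^sub>2)"
    using assms by simp_all
  thus ?thesis by simp
qed

lemma digit_cong:
  assumes "digit d - digit e = 2 * z" "z \<in> Qlat"
  shows "d = e"
proof -
  obtain m n where z: "z = of_int m * a\<^sub>1 + of_int n * a\<^sub>2" using assms by (auto simp: Qlat_def)
  have "of_int (of_bool (fst d)) * a\<^sub>1 + of_int (of_bool (snd d)) * a\<^sub>2 =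
    of_int (of_bool (fst e) + 2 * m) * a\<^sub>1 + of_int (of_bool (snd e) + 2 * n) * a\<^sub>2"
    using assms(1) unfolding digit_def z by (simp add: algebra_simps)
  hence "of_bool (fst d) = of_bool (fst e) + 2 * m" "of_bool (snd d) = of_bool (snd e) + 2 * n"
    using Qlat_coords by blast+
  hence "fst d = fst e" "snd d = snd e" by (auto simp: of_bool_def split: if_splits) presburger+
  thus ?thesis by (rule prod_eqI)
qed

lemma digit_ex:
  assumes "z \<in> Qlat"
  shows "\<exists>d z'. z' \<in> Qlat \<and> z = digit d + 2 * z'"
proof -
  obtain m n where z: "z = of_int m * a\<^sub>1 + of_int n * a\<^sub>2" using assms by (auto simp: Qlat_def)
  have *: "(of_int j :: complex) = of_bool (odd j) + 2 * of_int (j div 2)" for j :: int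
  proof -
    have "j = of_bool (odd j) + 2 * (j div 2)"
      by (metis add.commute mult_div_mod_eq odd_iff_mod_2_eq_one even_iff_mod_2_eq_zero of_bool_eq)
    hence "(of_int j :: complex) = of_int (of_bool (odd j) + 2 * (j div 2))" by simp
    thus ?thesis by simp
  qed
  have "z = digit (odd m, odd n) + 2 * (of_int (m div 2) * a\<^sub>1 + of_int (n div 2) * a\<^sub>2)"
    unfolding z digit_def by (subst *[of m], subst *[of n]) (simp only: fst_conv snd_conv algebra_simps)
  thus ?thesis unfolding Qlat_def by blast
qed

lemma digits_ex:
  assumes "v \<in> Qlat"
  shows "\<exists>e. digit_sum e k \<in> Qcoset k v"
proof (induction k)
  case 0
  have "digit_sum (\<lambda>_. (False, False)) 0 \<in> Qcoset 0 v"
    using assms by (auto simp: digit_sum_def Qcoset_iff intro: Qlat_uminus)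
  thus ?case by blast
next
  case (Suc k)
  then obtain e where "v \<in> Qcoset k (digit_sum e k)" using Qcoset_sym by blast
  then obtain z where z: "z \<in> Qlat" "v - digit_sum e k = 2 ^ k * z" by (auto simp: Qcoset_iff)
  obtain d z' where d: "z' \<in> Qlat" "z = digit d + 2 * z'" using digit_ex[OF z(1)] by blast
  have "digit_sum (e(k := d)) k = digit_sum e k" by (simp add: digit_sum_def)
  hence "v - digit_sum (e(k := d)) (Suc k) = v - digit_sum e k - 2 ^ k * digit d"
    by (simp add: digit_sum_def)
  also have "\<dots> = 2 ^ Suc k * z'" unfolding z d by (simp add: algebra_simps)
  finally have "v \<in> Qcoset (Suc k) (digit_sum (e(k := d)) (Suc k))"
    using d(1) unfolding Qcoset_iff by blast
  thus ?case using Qcoset_sym by blast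
qed

lemma digits_unique:
  assumes "digit_sum d k \<in> Qcoset k (digit_sum e k)" "i < k"
  shows "d i = e i"
  using assms
proof (induction k arbitrary: i)
  case (Suc k)
  have "digit_sum d (Suc k) \<in> Qcoset k (digit_sum e (Suc k))"
    using Suc.prems(1) Qcoset_Suc by blast
  moreover have "digit_sum d k \<in> Qcoset k (digit_sum d (Suc k))" for d
    using Qlat_uminus[OF digit_in_Qlat[of "d k"]] unfolding Qcoset_iff
    by (intro bexI[of _ "- digit (d k)"]) (simp_all add: digit_sum_def)
  ultimately have "digit_sum d k \<in> Qcoset k (digit_sum e k)"
    using Qcoset_trans Qcoset_sym by meson
  hence IH: "\<And>i. i < k \<Longrightarrow> d i = e i" using Suc.IH by blast
  hence eq: "digit_sum d k = digit_sum e k" by (simp add: digit_sum_def)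
  obtain z where z: "z \<in> Qlat" "digit_sum d (Suc k) - digit_sum e (Suc k) = 2 ^ Suc k * z"
    using Suc.prems(1) by (auto simp: Qcoset_iff)
  have "2 ^ k * (digit (d k) - digit (e k)) = digit_sum d (Suc k) - digit_sum e (Suc k)"
    using eq by (simp add: digit_sum_def algebra_simps)
  also have "\<dots> = 2 ^ k * (2 * z)" using z by simp
  finally have "digit (d k) - digit (e k) = 2 * z" by simp
  hence "d k = e k" using z(1) digit_cong by blast
  with IH Suc.prems(2) show ?case by (auto simp: less_Suc_eq)
qed simp

lemma compatible_digit_sum: "compatible (\<lambda>k. Qcoset k (digit_sum d k))"
  unfolding compatible_def
proof (intro conjI allI)
  fix k
  show "\<exists>v\<in>Qlat. Qcoset k (digit_sum d k) = Qcoset k v" using digit_sum_in_Qlat by blast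
  have "digit_sum d (Suc k) \<in> Qcoset k (digit_sum d k)"
    using digit_in_Qlat[of "d k"] unfolding Qcoset_iff
    by (intro bexI[of _ "digit (d k)"]) (simp_all add: digit_sum_def)
  hence "Qcoset k (digit_sum d (Suc k)) = Qcoset k (digit_sum d k)" by (simp add: Qcoset_eq_iff)
  thus "Qcoset (Suc k) (digit_sum d (Suc k)) \<subseteq> Qcoset k (digit_sum d k)"
    using Qcoset_Suc[of k "digit_sum d (Suc k)"] by simp
qed

lift_definition of_digits :: "(nat \<Rightarrow> bool \<times> bool) \<Rightarrow> qbar" is "\<lambda>d k. Qcoset k (digit_sum d k)"
  by (simp add: compatible_digit_sum)

lemma of_digits_vimage: "\<exists>e. of_digits -` qcyl k y = {d. \<forall>i\<in>{..<k}. d i \<in> {e i}}"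
proof -
  obtain v where v: "v \<in> Qlat" "qcomp y k = Qcoset k v" using qcomp_ex[of y k] by blast
  obtain e where "digit_sum e k \<in> Qcoset k v" using digits_ex[OF v(1)] by blast
  hence e: "qcomp y k = Qcoset k (digit_sum e k)" using v(2) Qcoset_eq_iff by metis
  have "of_digits d \<in> qcyl k y \<longleftrightarrow> (\<forall>i\<in>{..<k}. d i \<in> {e i})" for d
  proof
    assume "of_digits d \<in> qcyl k y"
    hence "digit_sum d k \<in> Qcoset k (digit_sum e k)"
      by (simp add: qcyl_def of_digits.rep_eq e Qcoset_eq_iff)
    thus "\<forall>i\<in>{..<k}. d i \<in> {e i}" using digits_unique by auto
  next
    assume "\<forall>i\<in>{..<k}. d i \<in> {e i}"
    hence "digit_sum d k = digit_sum e k" by (simp add: digit_sum_def)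
    thus "of_digits d \<in> qcyl k y" by (simp add: qcyl_def of_digits.rep_eq e)
  qed
  thus ?thesis by blast
qed

lemma is_haar_ex: "\<exists>\<mu> :: qbar measure. is_haar \<mu>"
proof -
  define D where "D = measure_pmf (pmf_of_set (UNIV :: (bool \<times> bool) set))"
  interpret product_prob_space "\<lambda>_::nat. D" UNIV
    unfolding D_def by unfold_locales
  let ?p = "ennreal (1 / real (card (UNIV :: (bool \<times> bool) set)))"
  have sets_D: "sets D = UNIV" and space_D: "space D = UNIV" by (simp_all add: D_def)
  let ?M = "PiM (UNIV :: nat set) (\<lambda>_. D)"
  have space_M: "space ?M = UNIV" by (simp add: space_PiM space_D)
  have box: "{d. \<forall>i\<in>{..<k}. d i \<in> {e i}} \<in> sets ?M" (is ?th1)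
    "emeasure ?M {d. \<forall>i\<in>{..<k}. d i \<in> {e i}} = ?p ^ k" (is ?th2) for k and e :: "nat \<Rightarrow> bool \<times> bool"
  proof -
    have "{d \<in> space ?M. \<forall>i\<in>{..<k}. d i \<in> {e i}} \<in> sets ?M"
    proof (rule sets.sets_Collect_finite_All)
      fix i assume "i \<in> {..<k}"
      show "{d \<in> space ?M. d i \<in> {e i}} \<in> sets ?M"
        by (rule sets_Collect_single) (simp_all add: sets_D)
    qed simp
    thus ?th1 by (simp add: space_M)
    have "emeasure ?M {d \<in> space ?M. \<forall>i\<in>{..<k}. d i \<in> {e i}} = (\<Prod>i\<in>{..<k}. emeasure D {e i})"
      by (rule emeasure_PiM_Collect) (simp_all add: sets_D)
    also have "\<dots> = (\<Prod>i\<in>{..<k}. ?p)"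
      by (rule prod.cong) (simp_all add: D_def emeasure_pmf_single)
    also have "\<dots> = ?p ^ k" by simp
    finally show ?th2 by (simp add: space_M)
  qed
  have meas: "of_digits \<in> measurable ?M borel"
    unfolding borel_qbar
  proof (rule measurable_measure_of)
    fix A assume "A \<in> qcyls"
    then consider "A = {}" | k y where "A = qcyl k y" by (auto simp: qcyls_def)
    thus "of_digits -` A \<inter> space ?M \<in> sets ?M"
    proof cases
      case 2
      obtain e where "of_digits -` qcyl k y = {d. \<forall>i\<in>{..<k}. d i \<in> {e i}}"
        using of_digits_vimage by blast
      thus ?thesis using 2 box(1) by (simp add: space_M)
    qed simp
  qed simp_all
  define \<mu> where "\<mu> = distr ?M borel of_digits"
  have sets_\<mu>: "sets \<mu> = sets borel" and space_\<mu>: "space \<mu> = UNIV" by (simp_all add: \<mu>_def)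
  have qcyl: "emeasure \<mu> (qcyl k y) = ?p ^ k" for k y
  proof -
    obtain e where e: "of_digits -` qcyl k y = {d. \<forall>i\<in>{..<k}. d i \<in> {e i}}"
      using of_digits_vimage by blast
    have "emeasure \<mu> (qcyl k y) = emeasure ?M (of_digits -` qcyl k y \<inter> space ?M)"
      unfolding \<mu>_def by (rule emeasure_distr[OF meas]) (simp add: open_qcyl)
    thus ?thesis using box(2)[of k e] by (simp add: e space_M)
  qed
  have one: "emeasure \<mu> UNIV = 1"
    using emeasure_distr[OF meas, of UNIV] P.emeasure_space_1 by (simp add: \<mu>_def space_M)
  have "emeasure \<mu> ((+) g ` A) = emeasure \<mu> A" if A: "A \<in> sets borel" for g A
  proof -
    have vim: "(+) (- g) -` B = (+) g ` B" for B :: "qbar set"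
    proof (intro equalityI subsetI)
      fix x assume "x \<in> (+) (- g) -` B"
      hence "- g + x \<in> B" by simp
      thus "x \<in> (+) g ` B" by (intro image_eqI[of _ _ "- g + x"]) (simp_all add: add.assoc [symmetric])
    qed (auto simp: add.assoc [symmetric])
    have tm: "(+) (- g) \<in> measurable \<mu> borel"
      unfolding borel_qbar
    proof (rule measurable_measure_of)
      fix B assume "B \<in> qcyls"
      then consider "B = {}" | k y where "B = qcyl k y" by (auto simp: qcyls_def)
      hence "(+) g ` B \<in> qcyls"
      proof cases
        case 2
        hence "(+) g ` B = qcyl k (g + y)" by (simp only: translate_qcyl)
        thus ?thesis unfolding qcyls_def by blast
      qed (simp add: qcyls_def)
      hence "(+) g ` B \<in> sets borel" using open_qcyl by (auto simp: qcyls_def)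
      thus "(+) (- g) -` B \<inter> space \<mu> \<in> sets \<mu>" by (simp add: vim sets_\<mu> space_\<mu>)
    qed simp_all
    have "\<mu> = distr \<mu> borel ((+) (- g))"
    proof (rule measure_eqI_qcyls)
      fix k y
      have "emeasure (distr \<mu> borel ((+) (- g))) (qcyl k y) = emeasure \<mu> ((+) (- g) -` qcyl k y \<inter> space \<mu>)"
        by (rule emeasure_distr[OF tm]) (simp add: open_qcyl)
      thus "emeasure \<mu> (qcyl k y) = emeasure (distr \<mu> borel ((+) (- g))) (qcyl k y)"
        by (simp add: vim space_\<mu> translate_qcyl qcyl)
    qed (simp_all add: sets_\<mu> one)
    hence "emeasure \<mu> A = emeasure (distr \<mu> borel ((+) (- g))) A" by simp
    also have "\<dots> = emeasure \<mu> ((+) (- g) -` A \<inter> space \<mu>)" by (rule emeasure_distr[OF tm A])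
    finally show ?thesis by (simp add: vim space_\<mu>)
  qed
  hence "is_haar \<mu>" by (simp add: is_haar_def sets_\<mu> one)
  thus ?thesis ..
qed

definition haar :: "qbar measure" where
  "haar = (THE \<mu>. is_haar \<mu>)"

text \<open>By \<open>is_haar_ex\<close> and \<open>is_haar_unique\<close> the description is proper.\<close>

lemma is_haar_haar: "is_haar haar"
  unfolding haar_def using is_haar_ex is_haar_unique by (metis theI)

definition curlywedge :: "qbar set \<Rightarrow> complex set" where
  "curlywedge W = {x \<in> Qlat. star x \<in> W}"

definition is_model_set :: "complex set \<Rightarrow> qbar set \<Rightarrow> bool" where
  "is_model_set S W \<longleftrightarrow> S = curlywedge W \<and> interior W \<subseteq> W \<and> W \<subseteq> closure (interior W) \<and>
     closure (interior W) = closure W \<and> compact (closure W)"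

definition is_regular_model_set :: "complex set \<Rightarrow> qbar set \<Rightarrow> bool" where
  "is_regular_model_set S W \<longleftrightarrow> is_model_set S W \<and> emeasure haar (closure W - interior W) = 0"

text \<open>\<open>qcomp q k\<close> is the vertex set \<open>v\<^sub>k + 2\<^sup>k Q\<close>.  A triangle is given by its set of three vertices,
  an edge is the closed segment.\<close>

definition level_edges :: "qbar \<Rightarrow> nat \<Rightarrow> complex set set" where
  "level_edges q k = {closed_segment u v | u v. u \<in> qcomp q k \<and> v \<in> qcomp q k \<and> dist u v = 2 ^ k}"

definition level_triangles :: "qbar \<Rightarrow> nat \<Rightarrow> complex set set" where
  "level_triangles q k = {{u, v, w} | u v w. {u, v, w} \<subseteq> qcomp q k \<and>
     dist u v = 2 ^ k \<and> dist v w = 2 ^ k \<and> dist u w = 2 ^ k}"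

definition centroid :: "complex set \<Rightarrow> complex" where
  "centroid T = (\<Sum>v\<in>T. v) / of_nat (card T)"

definition is_midsegment :: "complex set \<Rightarrow> complex set \<Rightarrow> bool" where
  "is_midsegment e T \<longleftrightarrow> (\<exists>u v w. T = {u, v, w} \<and> u \<noteq> v \<and> v \<noteq> w \<and> u \<noteq> w \<and>
     e = closed_segment (midpoint u v) (midpoint u w))"

definition line :: "complex \<Rightarrow> complex \<Rightarrow> complex set" where
  "line x d = {x + of_real t * d | t. True}"

definition a_level :: "qbar \<Rightarrow> complex set \<Rightarrow> enat" where
  "a_level q L = (SUP k \<in> {k. \<exists>e\<in>level_edges q k. e \<subseteq> L}. enat k)"

definition w_level :: "qbar \<Rightarrow> complex set \<Rightarrow> enat" where
  "w_level q L = (SUP k \<in> {k. \<exists>T\<in>level_triangles q k. centroid T \<in> L}. enat k)"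

definition generic :: "qbar \<Rightarrow> bool" where
  "generic q \<longleftrightarrow>
     (\<forall>x\<in>Qlat. \<forall>d\<in>a_dirs. a_level q (line x d) \<noteq> \<infinity>) \<and>
     (\<forall>x\<in>Qlat. \<forall>w\<in>w_dirs. w_level q (line x w) \<noteq> \<infinity>)"

text \<open>\<open>stripe_dir\<close> spans the stripe direction.  The other two fields are the vertices (relative to
  the center) on the long diagonal perpendicular to the stripe that tell, respectively, to which side
  the stripe is displaced and which half of that diagonal is red.\<close>

record tile =
  stripe_dir :: complex
  stripe_side :: complex
  red_end :: complex

definition valid_tile :: "tile \<Rightarrow> bool" where
  "valid_tile t \<longleftrightarrow> stripe_dir t \<in> a_dirs \<and>
     stripe_side t \<in> Omega \<and> inner (stripe_side t) (stripe_dir t) = 0 \<and>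
     red_end t \<in> Omega \<and> inner (red_end t) (stripe_dir t) = 0"

type_synonym tiling = "complex \<Rightarrow> tile"

definition hexagon :: "complex \<Rightarrow> complex set" where
  "hexagon x = convex hull ((+) x ` Omega)"

definition stripe :: "real \<Rightarrow> tile \<Rightarrow> complex \<Rightarrow> complex set" where
  "stripe \<epsilon> t x = (let c = x + of_real \<epsilon> * sgn (stripe_side t)
     in closed_segment (c - stripe_dir t / 2) (c + stripe_dir t / 2))"

text \<open>The endpoint, on the edge of the hexagon with vertices \<open>x + u\<close> and \<open>x + u'\<close>, of a leg
  displaced from the edge midpoint towards \<open>x + u\<close>.\<close>

definition leg_end :: "real \<Rightarrow> complex \<Rightarrow> complex \<Rightarrow> complex \<Rightarrow> complex" where
  "leg_end \<epsilon> x u u' = x + midpoint u u' + of_real \<epsilon> * sgn (u - u')"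

text \<open>The V at the vertex \<open>x + u\<close>: its legs, being perpendicular to the edges with endpoints
  \<open>x + u\<close> and \<open>x + u * cis (\<plusminus> pi / 3)\<close>, meet at distance \<open>2\<epsilon>\<close> from \<open>x\<close>.\<close>

definition vee :: "real \<Rightarrow> complex \<Rightarrow> complex \<Rightarrow> complex set" where
  "vee \<epsilon> x u = (let c = x + of_real (2 * \<epsilon>) * sgn u in
     closed_segment (leg_end \<epsilon> x u (u * cis (pi / 3))) c \<union>
     closed_segment (leg_end \<epsilon> x u (u * cis (- pi / 3))) c)"

definition black_lines :: "real \<Rightarrow> tile \<Rightarrow> complex \<Rightarrow> complex set" where
  "black_lines \<epsilon> t x = stripe \<epsilon> t x \<union> vee \<epsilon> x (stripe_side t) \<union> vee \<epsilon> x (- stripe_side t)"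

datatype colour = Red | Blue

text \<open>The colour of the half of a long diagonal from the center to the vertex \<open>w\<close> (relative to the
  center).\<close>

definition half_colour :: "tile \<Rightarrow> complex \<Rightarrow> colour" where
  "half_colour t w =
     (if w \<in> line 0 (stripe_dir t * cis (- pi / 6)) then Red
      else if w \<in> line 0 (stripe_dir t * cis (pi / 6)) then Blue
      else if w = red_end t then Red else Blue)"

definition rule1 :: "real \<Rightarrow> tiling \<Rightarrow> bool" where
  "rule1 \<epsilon> \<Lambda> \<longleftrightarrow> (\<forall>x\<in>Qlat. \<forall>y\<in>Qlat. x \<noteq> y \<longrightarrow>
     black_lines \<epsilon> (\<Lambda> x) x \<inter> (hexagon x \<inter> hexagon y) =
     black_lines \<epsilon> (\<Lambda> y) y \<inter> (hexagon x \<inter> hexagon y))"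

definition rule2 :: "tiling \<Rightarrow> bool" where
  "rule2 \<Lambda> \<longleftrightarrow> (\<forall>x\<in>Qlat. \<forall>w\<in>Omega. half_colour (\<Lambda> x) w \<noteq> half_colour (\<Lambda> (x + 3 * w)) (- w))"

definition X_Q :: "real \<Rightarrow> tiling set" where
  "X_Q \<epsilon> = {\<Lambda>. (\<forall>x\<in>Qlat. valid_tile (\<Lambda> x)) \<and> rule1 \<epsilon> \<Lambda> \<and> rule2 \<Lambda>}"

definition stripe_crosses :: "real \<Rightarrow> tile \<Rightarrow> complex \<Rightarrow> colour \<Rightarrow> bool" where
  "stripe_crosses \<epsilon> t x c \<longleftrightarrow> (\<exists>w\<in>Omega. inner w (stripe_dir t) = 0 \<and> half_colour t w = c \<and>
     stripe \<epsilon> t x \<inter> closed_segment x (x + w) \<noteq> {})"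

definition Q_wh :: "real \<Rightarrow> tiling \<Rightarrow> complex set" where
  "Q_wh \<epsilon> \<Lambda> = {x \<in> Qlat. stripe_crosses \<epsilon> (\<Lambda> x) x Red}"

definition Q_gr :: "real \<Rightarrow> tiling \<Rightarrow> complex set" where
  "Q_gr \<epsilon> \<Lambda> = {x \<in> Qlat. stripe_crosses \<epsilon> (\<Lambda> x) x Blue}"

text \<open>The graph of the map \<open>\<xi>\<close>: \<open>is_xi \<Lambda> q\<close> is the property that singles out
  \<open>q = \<xi>(\<Lambda>)\<close> as the unique such \<open>q\<close>.  The hypothesis on \<open>x\<close> excludes points on three a-lines of
  infinite level; \<open>centroid T - x\<close> is compared with the vertex \<open>stripe_side\<close>, which is perpendicular
  to the stripe.\<close>

definition is_xi :: "tiling \<Rightarrow> qbar \<Rightarrow> bool" where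
  "is_xi \<Lambda> q \<longleftrightarrow> (\<forall>x\<in>Qlat. \<not> (\<forall>d\<in>a_dirs. a_level q (line x d) = \<infinity>) \<longrightarrow>
     (let L = line x (stripe_dir (\<Lambda> x)) in
       (\<forall>d\<in>a_dirs. line x d \<noteq> L \<longrightarrow> a_level q (line x d) < a_level q L) \<and>
       (\<forall>k. a_level q L = enat k \<longrightarrow>
          (\<exists>e\<in>level_edges q k. \<exists>T\<in>level_triangles q (Suc k).
             x \<in> e \<and> e \<subseteq> L \<and> is_midsegment e T \<and> inner (stripe_side (\<Lambda> x)) (centroid T - x) > 0))))"

end

theory Submission
  imports Defs
begin

text \<open>
The colour of a tile is a locally constant function of its position in the 2-adic topology, at all lattice
points and at almost all points of the completion.  Everything else is formal: if a colouring of \<open>Q\<close> has this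
property, the points near which it has a given value \<open>c\<close> form an open set in which the lattice points of
colour \<open>c\<close> are dense; this set is a union of basic clopen sets, its closure contains no
lattice point of another colour, and its boundary lies in the null set of points without local constancy
(\<open>curlywedge_closure\<close>, \<open>regular_model_set\<close>).

For local constancy, describe a line by a normal \<open>u\<close>.  The level of the line through \<open>x\<close> with normal \<open>u\<close> is
the 2-adic valuation of an integral linear form, twice the inner product with \<open>u\<close>, at \<open>x - q\<close>; this covers both
a-lines and w-lines (\<open>a_level_ge_iff\<close>, \<open>w_level_ge\<close>).  A finite level is thus determined by \<open>x\<close> modulo a power
of 2, and so are the direction and the side of the stripe (\<open>stripe_dir_cong\<close>, \<open>stripe_side_cong\<close>).  The tile at
\<open>x\<close> is white or gray according to the colour of the half diagonal \<open>s\<close> on the side of the stripe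
(\<open>stripe_crosses_iff\<close>).  By the second matching rule this colour can be followed along the points
\<open>x + 3 n s\<close>; it alternates in a way dictated by the stripe directions there, and is
known at any point whose stripe is not perpendicular to \<open>s\<close> (\<open>half_colour_propagates\<close>).  Such a point exists
because the w-line has finite level (\<open>oblique_stripe_on_w_line\<close>).  So finitely many stripe directions
determine the colour, and it is constant near \<open>x\<close> (\<open>colour_locally_constant\<close>).

The argument applies to every point \<open>y\<close> of the completion such that no translate of \<open>y - q\<close> by a lattice vector
is annihilated by one of the linear forms.  Lattice points qualify by genericity.  The points that do not
qualify form a countable union of sets each having infinitely many disjoint translates, hence a Haar null set
(\<open>haar_regular_points\<close>).
\<close>

section \<open>Lattice vectors and their normals\<close>

text \<open>Perpendicular to an a-line is a vector of \<open>Omega\<close>, perpendicular to a w-line is a vector of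
\<open>a_dirs\<close>.  Taking both kinds as normal vectors lets one level function serve a-lines and
w-lines alike.\<close>

definition normals :: "complex set" where
  "normals = a_dirs \<union> Omega"

lemma a1_eq: "a\<^sub>1 = Complex 1 0" and a2_eq: "a\<^sub>2 = Complex (- 1 / 2) (sqrt 3 / 2)"
  and w1_eq: "w\<^sub>1 = Complex (1 / 2) (sqrt 3 / 6)" and w2_eq: "w\<^sub>2 = Complex 0 (sqrt 3 / 3)"
  by (simp_all add: a\<^sub>1_def a\<^sub>2_def w\<^sub>1_def w\<^sub>2_def complex_eq_iff)

lemmas vector_eqs = a1_eq a2_eq w1_eq w2_eq

lemma Omega_eq: "Omega = {Complex (1 / 2) (sqrt 3 / 6), Complex (- 1 / 2) (- sqrt 3 / 6),
    Complex 0 (sqrt 3 / 3), Complex 0 (- sqrt 3 / 3),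
    Complex (- 1 / 2) (sqrt 3 / 6), Complex (1 / 2) (- sqrt 3 / 6)}"
proof -
  have "- w\<^sub>1 = Complex (- 1 / 2) (- sqrt 3 / 6)" "- w\<^sub>2 = Complex 0 (- sqrt 3 / 3)"
    "w\<^sub>2 - w\<^sub>1 = Complex (- 1 / 2) (sqrt 3 / 6)" "- (w\<^sub>2 - w\<^sub>1) = Complex (1 / 2) (- sqrt 3 / 6)"
    by (simp_all add: vector_eqs complex_eq_iff)
  thus ?thesis by (simp only: Omega_def w1_eq w2_eq)
qed

lemma a_dirs_eq:
  "a_dirs = {Complex 1 0, Complex (- 1 / 2) (sqrt 3 / 2), Complex (1 / 2) (sqrt 3 / 2)}"
proof -
  have "a\<^sub>1 + a\<^sub>2 = Complex (1 / 2) (sqrt 3 / 2)" by (simp add: vector_eqs complex_eq_iff)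
  thus ?thesis by (simp only: a_dirs_def a1_eq a2_eq)
qed

lemma Qlat_a1 [simp]: "a\<^sub>1 \<in> Qlat"
  unfolding Qlat_def by (rule CollectI, rule exI[of _ 1], rule exI[of _ 0]) simp

lemma Qlat_a2 [simp]: "a\<^sub>2 \<in> Qlat"
  unfolding Qlat_def by (rule CollectI, rule exI[of _ 0], rule exI[of _ 1]) simp

lemma Qlat_of_int: "z \<in> Qlat \<Longrightarrow> of_int j * z \<in> Qlat"
proof -
  assume "z \<in> Qlat"
  then obtain m n where "z = of_int m * a\<^sub>1 + of_int n * a\<^sub>2" by (auto simp: Qlat_def)
  hence "of_int j * z = of_int (j * m) * a\<^sub>1 + of_int (j * n) * a\<^sub>2" by (simp add: algebra_simps)
  thus ?thesis unfolding Qlat_def by blast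
qed

lemma Qlat_of_nat: "z \<in> Qlat \<Longrightarrow> of_nat j * z \<in> Qlat"
  using Qlat_of_int[of z "int j"] by simp

lemma a_dirs_Qlat: "d \<in> a_dirs \<Longrightarrow> d \<in> Qlat"
  by (auto simp: a_dirs_def Qlat_add)

lemma norm_a_dirs: "d \<in> a_dirs \<Longrightarrow> norm d = 1"
  unfolding a_dirs_eq by (elim insertE emptyE; simp add: cmod_def power2_eq_square)

lemma a_dirs_nonzero: "d \<in> a_dirs \<Longrightarrow> d \<noteq> 0"
  using norm_a_dirs by fastforce

lemma Omega_nonzero: "w \<in> Omega \<Longrightarrow> w \<noteq> 0"
  by (auto simp: Omega_eq complex_eq_iff)

lemma Omega_uminus: "w \<in> Omega \<Longrightarrow> - w \<in> Omega"
  by (auto simp: Omega_def)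

lemma norm_Omega: "w \<in> Omega \<Longrightarrow> norm w = sqrt (1 / 3)"
  unfolding Omega_eq by (elim insertE emptyE; simp add: cmod_def power2_eq_square)

text \<open>The second colour rule compares the tiles at \<open>x\<close> and \<open>x + 3 * w\<close>, so \<open>3 * w\<close> is the step with
which colours travel.\<close>

lemma triple_Omega_Qlat:
  assumes "w \<in> Omega" shows "3 * w \<in> Qlat"
proof -
  have *: "3 * w\<^sub>1 = a\<^sub>1 + a\<^sub>1 + a\<^sub>2" "3 * w\<^sub>2 = a\<^sub>1 + a\<^sub>2 + a\<^sub>2" "3 * (w\<^sub>2 - w\<^sub>1) = a\<^sub>2 - a\<^sub>1"
    by (simp_all add: w\<^sub>1_def w\<^sub>2_def algebra_simps)
  have "3 * w\<^sub>1 \<in> Qlat" "3 * w\<^sub>2 \<in> Qlat" "3 * (w\<^sub>2 - w\<^sub>1) \<in> Qlat"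
    unfolding * by (intro Qlat_add Qlat_diff Qlat_a1 Qlat_a2)+
  moreover from this have "3 * - w\<^sub>1 \<in> Qlat" "3 * - w\<^sub>2 \<in> Qlat" "3 * - (w\<^sub>2 - w\<^sub>1) \<in> Qlat"
    by (metis Qlat_uminus mult_minus_right)+
  ultimately show ?thesis using assms unfolding Omega_def by blast
qed

text \<open>The norm form is \<open>m\<^sup>2 - m n + n\<^sup>2\<close>, a positive integer.  The uniqueness statements about edges and
triangles below rest on this: two points of one coset of \<open>2\<^sup>k Q\<close> at distance less than \<open>2\<^sup>k\<close> coincide.\<close>

lemma norm_Qlat_ge_1:
  assumes "z \<in> Qlat" "z \<noteq> 0"
  shows "1 \<le> norm z"
proof -
  obtain m n where z: "z = of_int m * a\<^sub>1 + of_int n * a\<^sub>2" using assms by (auto simp: Qlat_def)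
  have "norm z ^ 2 = (real_of_int m - real_of_int n / 2) ^ 2 + (real_of_int n * (sqrt 3 / 2)) ^ 2"
    unfolding z by (simp add: cmod_def)
  also have "\<dots> = real_of_int (m * m - m * n + n * n)"
    by (simp add: power2_eq_square algebra_simps)
  finally have *: "norm z ^ 2 = real_of_int (m * m - m * n + n * n)" .
  have "0 < norm z ^ 2" using assms(2) by simp
  hence "0 < m * m - m * n + n * n" unfolding * by linarith
  hence "1 \<le> norm z ^ 2" unfolding * by linarith
  thus ?thesis by (intro power2_le_imp_le[of 1]) simp_all
qed

text \<open>For each normal \<open>u\<close> the functional \<open>z \<mapsto> 2 * inner z u\<close> is an integer linear form in the coordinates
\<open>(m, n)\<close>: it is \<open>m\<close>, \<open>n\<close>, \<open>n - m\<close> for \<open>w\<^sub>1\<close>, \<open>w\<^sub>2\<close>, \<open>w\<^sub>2 - w\<^sub>1\<close>, and \<open>2 m - n\<close>, \<open>2 n - m\<close>, \<open>m + n\<close> for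
\<open>a\<^sub>1\<close>, \<open>a\<^sub>2\<close>, \<open>a\<^sub>1 + a\<^sub>2\<close>.\<close>

lemma pairing_integral:
  assumes "z \<in> Qlat" "u \<in> normals"
  shows "\<exists>j::int. 2 * inner z u = of_int j"
proof -
  obtain m n where z: "z = of_int m * a\<^sub>1 + of_int n * a\<^sub>2" using assms by (auto simp: Qlat_def)
  have w: "2 * inner z w\<^sub>1 = of_int m" "2 * inner z w\<^sub>2 = of_int n"
    unfolding z by (simp_all add: inner_complex_def vector_eqs field_simps)
  have a: "2 * inner z a\<^sub>1 = of_int (2 * m - n)" "2 * inner z a\<^sub>2 = of_int (2 * n - m)"
    unfolding z by (simp_all add: inner_complex_def vector_eqs field_simps)
  have "2 * inner z (a\<^sub>1 + a\<^sub>2) = of_int (m + n)" "2 * inner z (w\<^sub>2 - w\<^sub>1) = of_int (n - m)"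
    using a w by (simp_all add: inner_add_right inner_diff_right algebra_simps)
  moreover from this w have "2 * inner z (- w\<^sub>1) = of_int (- m)" "2 * inner z (- w\<^sub>2) = of_int (- n)"
    "2 * inner z (- (w\<^sub>2 - w\<^sub>1)) = of_int (- (n - m))" by (simp_all add: inner_minus_right inner_diff_right)
  ultimately show ?thesis using a w assms(2)
    unfolding normals_def a_dirs_def Omega_def by blast
qed

lemma pairing_surj:
  assumes "u \<in> normals"
  shows "\<exists>z\<in>Qlat. 2 * inner z u = of_int j"
proof -
  have "\<exists>z\<in>Qlat. 2 * inner z u = 1 \<or> 2 * inner z u = - 1"
  proof -
    have "\<exists>z\<in>{a\<^sub>1, a\<^sub>2}. 2 * inner z u = 1 \<or> 2 * inner z u = - 1"
      using assms unfolding normals_def a_dirs_eq Omega_eq Un_iff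
      by (elim disjE insertE emptyE; simp add: inner_complex_def vector_eqs)
    thus ?thesis by auto
  qed
  then obtain z i where z: "z \<in> Qlat" "2 * inner z u = of_int i" "i = 1 \<or> i = - 1"
    by (metis of_int_1 of_int_minus)
  have "2 * inner (of_int (i * j) * z) u = of_int (i * j) * (2 * inner z u)"
    by (simp add: inner_complex_def algebra_simps)
  also have "\<dots> = of_int j" using z(2,3) by auto
  finally show ?thesis using Qlat_of_int[OF z(1)] by blast
qed

lemma perp_imp_multiple:
  fixes d w :: complex
  assumes "inner d w = 0" "d \<noteq> 0"
  shows "\<exists>r. w = of_real r * \<i> * d"
proof -
  have "Re (w / d) = 0"
    using assms(1) by (simp add: Re_divide inner_complex_def mult.commute)
  hence "w / d = of_real (Im (w / d)) * \<i>" by (simp add: complex_eq_iff)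
  hence "w = of_real (Im (w / d)) * \<i> * d" using assms(2) by (metis nonzero_eq_divide_eq)
  thus ?thesis ..
qed

text \<open>In the plane incidence with a line is a single linear equation.  All levels are computed from it.\<close>

lemma line_iff_perp:
  assumes "inner d w = 0" "d \<noteq> 0" "w \<noteq> 0"
  shows "y \<in> line x d \<longleftrightarrow> inner (y - x) w = 0"
proof
  assume "y \<in> line x d"
  then obtain t where "y - x = t *\<^sub>R d" unfolding line_def scaleR_conv_of_real by force
  thus "inner (y - x) w = 0" using assms(1) by simp
next
  assume "inner (y - x) w = 0"
  hence "inner w (y - x) = 0" by (simp add: inner_commute)
  from perp_imp_multiple[OF this assms(3)] obtain r where r: "y - x = of_real r * \<i> * w" ..
  from perp_imp_multiple[OF assms(1,2)] obtain r' where r': "w = of_real r' * \<i> * d" ..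
  have "y = x + of_real (- (r * r')) * d" using r r' by (simp add: algebra_simps)
  thus "y \<in> line x d" unfolding line_def by blast
qed

lemma a_dirs_perp_ex: 
  assumes "d \<in> a_dirs" shows "\<exists>w\<in>Omega. inner w d = 0"
  using assms unfolding a_dirs_eq Omega_eq
  by (elim insertE emptyE) (simp_all add: inner_complex_def)

lemma a_dirs_perp_unique:
  assumes "w \<in> Omega" "d \<in> a_dirs" "d' \<in> a_dirs" "inner w d = 0" "inner w d' = 0"
  shows "d = d'"
  using assms unfolding a_dirs_eq Omega_eq
  by (elim insertE emptyE; simp add: inner_complex_def)

lemma Omega_perp_unique:
  assumes "w \<in> Omega" "w' \<in> Omega" "d \<in> a_dirs" "inner w d = 0" "inner w' d = 0"
  shows "w' = w \<or> w' = - w"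
  using assms unfolding a_dirs_eq Omega_eq
  by (elim insertE emptyE; simp add: inner_complex_def complex_eq_iff)

text \<open>The vectors \<open>s\<close>, \<open>d\<close> have lengths \<open>1 / sqrt 3\<close> and \<open>1\<close>, so \<open>(s - d) / 2\<close> has length \<open>1 / sqrt 3\<close> and makes
an angle of 60 degrees with \<open>s\<close>.  Hence \<open>s = 2 * w + d\<close> with \<open>w \<in> Omega\<close>, which links the levels of the
three lines with normals \<open>s\<close>, \<open>w\<close> and \<open>d\<close>.\<close>

lemma Omega_half_diff:
  assumes "s \<in> Omega" "d \<in> a_dirs" "inner s d = 0"
  shows "(s - d) / 2 \<in> Omega"
  using assms unfolding a_dirs_eq Omega_eq
  by (elim insertE emptyE; simp add: inner_complex_def complex_eq_iff)

section \<open>Levels of lines\<close>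

definition pairing_div :: "nat \<Rightarrow> complex \<Rightarrow> complex \<Rightarrow> bool" where
  "pairing_div k u z \<longleftrightarrow> (\<exists>j::int. 2 * inner z u = 2 ^ k * of_int j)"

lemma pairing_div_0 [simp]: "pairing_div k u 0"
  unfolding pairing_div_def by (rule exI[of _ 0]) simp

lemma pairing_div_add: "pairing_div k u x \<Longrightarrow> pairing_div k u y \<Longrightarrow> pairing_div k u (x + y)"
  unfolding pairing_div_def
proof (elim exE)
  fix i j :: int assume "2 * inner x u = 2 ^ k * of_int i" "2 * inner y u = 2 ^ k * of_int j"
  hence "2 * inner (x + y) u = 2 ^ k * of_int (i + j)" by (simp add: inner_add_left algebra_simps)
  thus "\<exists>j::int. 2 * inner (x + y) u = 2 ^ k * of_int j" ..
qed

lemma pairing_div_uminus: "pairing_div k u x \<Longrightarrow> pairing_div k u (- x)"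
  unfolding pairing_div_def
proof (elim exE)
  fix j :: int assume "2 * inner x u = 2 ^ k * of_int j"
  hence "2 * inner (- x) u = 2 ^ k * of_int (- j)" by simp
  thus "\<exists>j::int. 2 * inner (- x) u = 2 ^ k * of_int j" ..
qed

lemma pairing_div_diff: "pairing_div k u x \<Longrightarrow> pairing_div k u y \<Longrightarrow> pairing_div k u (x - y)"
  using pairing_div_add[of k u x "- y"] pairing_div_uminus by simp

lemma inner_pow2: "inner (2 ^ k * z) u = 2 ^ k * inner z (u :: complex)"
proof -
  have "2 ^ k * z = (2 ^ k) *\<^sub>R z" by (simp add: scaleR_conv_of_real)
  thus ?thesis by simp
qed

lemma pairing_div_pow2:
  assumes "u \<in> normals" "z \<in> Qlat"
  shows "pairing_div k u (2 ^ k * z)"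
proof -
  obtain j :: int where "2 * inner z u = of_int j" using pairing_integral assms by blast
  hence "2 * inner (2 ^ k * z) u = 2 ^ k * of_int j" by (simp add: inner_pow2)
  thus ?thesis unfolding pairing_div_def ..
qed

lemma pairing_div_mono: "j \<le> k \<Longrightarrow> pairing_div k u z \<Longrightarrow> pairing_div j u z"
  unfolding pairing_div_def
proof (elim exE)
  fix i :: int assume "j \<le> k" "2 * inner z u = 2 ^ k * of_int i"
  moreover have "2 ^ k = (2 ^ j * 2 ^ (k - j) :: real)" using \<open>j \<le> k\<close> by (simp flip: power_add)
  ultimately have "2 * inner z u = 2 ^ j * of_int (2 ^ (k - j) * i)" by simp
  thus "\<exists>i::int. 2 * inner z u = 2 ^ j * of_int i" ..
qed

text \<open>The line through \<open>x\<close> with normal \<open>u\<close> has level at least \<open>k\<close>.  Since \<open>q\<close> is known modulo \<open>2\<^sup>k Q\<close> only,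
any representative \<open>v\<close> may be used; see \<open>line_level_ge_iff\<close>.  The condition depends on \<open>x\<close> modulo
\<open>2\<^sup>k Q\<close> only, and this is the source of all continuity below.\<close>

definition line_level_ge :: "qbar \<Rightarrow> nat \<Rightarrow> complex \<Rightarrow> complex \<Rightarrow> bool" where
  "line_level_ge q k u x \<longleftrightarrow> (\<exists>v\<in>qcomp q k. pairing_div k u (x - v))"

lemma qcomp_Qlat: "v \<in> qcomp q k \<Longrightarrow> v \<in> Qlat"
  using qcomp_ex[of q k] by (auto simp: Qcoset_def intro!: Qlat_add Qlat_pow2)

lemma qcomp_nonempty: "\<exists>v. v \<in> qcomp q k"
  using qcomp_ex[of q k] Qcoset_self by blast

lemma qcomp_diff: "u \<in> qcomp q k \<Longrightarrow> v \<in> qcomp q k \<Longrightarrow> \<exists>z\<in>Qlat. u - v = 2 ^ k * z"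
  using qcomp_eq[of v q k] by (auto simp: Qcoset_iff)

lemma qcomp_add: "v \<in> qcomp q k \<Longrightarrow> z \<in> Qlat \<Longrightarrow> v + 2 ^ k * z \<in> qcomp q k"
  using qcomp_eq[of v q k] by (auto simp: Qcoset_iff)

lemma line_level_ge_iff:
  assumes "u \<in> normals" "v \<in> qcomp q k"
  shows "line_level_ge q k u x \<longleftrightarrow> pairing_div k u (x - v)"
proof
  assume "line_level_ge q k u x"
  then obtain v' where v': "v' \<in> qcomp q k" "pairing_div k u (x - v')"
    by (auto simp: line_level_ge_def)
  obtain z where z: "z \<in> Qlat" "v' - v = 2 ^ k * z" using qcomp_diff[OF v'(1) assms(2)] by blast
  have "x - v = (x - v') + 2 ^ k * z" using z(2) by (simp add: algebra_simps)
  thus "pairing_div k u (x - v)"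
    using pairing_div_add[OF v'(2) pairing_div_pow2[OF assms(1) z(1)]] by (simp only:)
qed (use assms in \<open>auto simp: line_level_ge_def\<close>)

lemma line_level_ge_cong:
  assumes "u \<in> normals" "x' \<in> Qcoset k x"
  shows "line_level_ge q k u x' \<longleftrightarrow> line_level_ge q k u x"
proof -
  obtain v where v: "v \<in> qcomp q k" using qcomp_nonempty by blast
  obtain z where z: "z \<in> Qlat" "x' - x = 2 ^ k * z" using assms(2) by (auto simp: Qcoset_iff)
  have "x' - v = (x - v) + 2 ^ k * z" "x - v = (x' - v) - 2 ^ k * z"
    using z(2) by (simp_all add: algebra_simps)
  thus ?thesis unfolding line_level_ge_iff[OF assms(1) v]
    using pairing_div_add pairing_div_diff pairing_div_pow2[OF assms(1) z(1)] by metis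
qed

lemma line_level_ge_mono: "j \<le> k \<Longrightarrow> line_level_ge q k u x \<Longrightarrow> line_level_ge q j u x"
  unfolding line_level_ge_def using pairing_div_mono qcomp_antimono by blast

lemma line_level_ge_vertex: "x \<in> qcomp q k \<Longrightarrow> line_level_ge q k u x"
  unfolding line_level_ge_def by (intro bexI[of _ x]) simp_all

text \<open>An a-line contains a level-\<open>k\<close> edge iff it contains a vertex of level \<open>k\<close>: from a vertex, the edge in
the direction of the line is one.  A vertex on the line is found by correcting \<open>v\<close> by a suitable
lattice vector, which exists since the pairing with a normal takes every integer value.\<close>

lemma level_edge_on_line_iff:
  assumes "d \<in> a_dirs" "w \<in> Omega" "inner w d = 0" "x \<in> Qlat"
  shows "(\<exists>e\<in>level_edges q k. e \<subseteq> line x d) \<longleftrightarrow> line_level_ge q k w x"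
proof
  have nz: "d \<noteq> 0" "w \<noteq> 0" and dw: "inner d w = 0"
    using assms a_dirs_nonzero Omega_nonzero by (auto simp: inner_commute)
  note line = line_iff_perp[OF dw nz]
  have w: "w \<in> normals" using assms(2) by (simp add: normals_def)
  {
    assume "\<exists>e\<in>level_edges q k. e \<subseteq> line x d"
    then obtain v v' where v: "v \<in> qcomp q k" "closed_segment v v' \<subseteq> line x d"
      by (auto simp: level_edges_def)
    hence "inner (v - x) w = 0" using line by auto
    hence "2 * inner (x - v) w = 2 ^ k * of_int 0" by (simp add: inner_diff_left)
    hence "pairing_div k w (x - v)" unfolding pairing_div_def by blast
    thus "line_level_ge q k w x" using v unfolding line_level_ge_def by blast
  next
    assume "line_level_ge q k w x"
    then obtain v j where v: "v \<in> qcomp q k" "2 * inner (x - v) w = 2 ^ k * of_int j"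
      by (auto simp: line_level_ge_def pairing_div_def)
    obtain z where z: "z \<in> Qlat" "2 * inner z w = of_int j" using pairing_surj[OF w] by blast
    define p where "p = v + 2 ^ k * z"
    have p: "p \<in> qcomp q k" unfolding p_def using v(1) z(1) by (rule qcomp_add)
    have p': "p + 2 ^ k * d \<in> qcomp q k" using p a_dirs_Qlat[OF assms(1)] by (rule qcomp_add)
    have "2 * inner (p - x) w = 2 ^ k * (2 * inner z w) - 2 * inner (x - v) w"
      by (simp add: p_def inner_add_left inner_diff_left inner_pow2)
    hence px: "inner (p - x) w = 0" using v(2) z(2) by simp
    have "closed_segment p (p + 2 ^ k * d) \<subseteq> line x d"
    proof
      fix y assume "y \<in> closed_segment p (p + 2 ^ k * d)"
      then obtain t where "y - x = (p - x) + t *\<^sub>R (2 ^ k * d)"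
        by (auto simp: closed_segment_def algebra_simps)
      hence "inner (y - x) w = inner (p - x) w + t * (2 ^ k * inner d w)"
        by (simp only: inner_add_left inner_scaleR_left inner_pow2)
      hence "inner (y - x) w = 0" using px dw by simp
      thus "y \<in> line x d" by (simp add: line)
    qed
    moreover have "dist p (p + 2 ^ k * d) = 2 ^ k"
      using norm_a_dirs[OF assms(1)] by (simp add: dist_norm norm_mult norm_power)
    ultimately show "\<exists>e\<in>level_edges q k. e \<subseteq> line x d"
      using p p' unfolding level_edges_def by blast
  }
qed

lemma a_level_ge_iff:
  assumes "d \<in> a_dirs" "w \<in> Omega" "inner w d = 0" "x \<in> Qlat"
  shows "enat k \<le> a_level q (line x d) \<longleftrightarrow> line_level_ge q k w x"
proof -
  have eq: "a_level q (line x d) = (SUP k \<in> {k. line_level_ge q k w x}. enat k)"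
    unfolding a_level_def level_edge_on_line_iff[OF assms] ..
  show ?thesis
  proof
    assume "line_level_ge q k w x"
    thus "enat k \<le> a_level q (line x d)" unfolding eq by (intro SUP_upper) simp
  next
    assume le: "enat k \<le> a_level q (line x d)"
    show "line_level_ge q k w x"
    proof (rule ccontr)
      assume not: "\<not> line_level_ge q k w x"
      have w: "w \<in> normals" using assms(2) by (simp add: normals_def)
      obtain v where v: "v \<in> qcomp q 0" using qcomp_nonempty by blast
      have "pairing_div 0 w (x - v)"
        using pairing_div_pow2[OF w, of "x - v" 0] assms(4) qcomp_Qlat[OF v] by (simp add: Qlat_diff)
      hence "line_level_ge q 0 w x" using v unfolding line_level_ge_def by blast
      \<comment> \<open>Level 0 always occurs, so the supremum is not that of the empty set.\<close>
      with not have k: "k > 0" by (cases k) auto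
      have "i \<le> k - 1" if "line_level_ge q i w x" for i
        using that not line_level_ge_mono[of k i q w x] by (cases "k \<le> i") auto
      hence "a_level q (line x d) \<le> enat (k - 1)" unfolding eq by (intro SUP_least) simp
      with le have "enat k \<le> enat (k - 1)" by (rule order_trans)
      with k show False by simp
    qed
  qed
qed

lemma a_level_infinite_iff:
  assumes "d \<in> a_dirs" "w \<in> Omega" "inner w d = 0" "x \<in> Qlat"
  shows "a_level q (line x d) = \<infinity> \<longleftrightarrow> (\<forall>k. line_level_ge q k w x)"
proof -
  have "a = \<infinity> \<longleftrightarrow> (\<forall>k. enat k \<le> a)" for a
  proof (cases a)
    case (enat n)
    hence "\<not> enat (Suc n) \<le> a" by simp
    with enat show ?thesis by blast
  qed simp
  thus ?thesis unfolding a_level_ge_iff[OF assms, symmetric] .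
qed

text \<open>A w-line contains a level-\<open>k\<close> centroid as soon as it contains a level-\<open>k\<close> vertex \<open>p\<close>: the direction \<open>w\<close>
bisects the angle of a triangle at \<open>p\<close>, whose centroid is \<open>p + 2 ^ k * w\<close>.\<close>

lemma w_level_ge:
  assumes "w \<in> w_dirs" "d \<in> a_dirs" "inner w d = 0" "x \<in> Qlat" "line_level_ge q k d x"
  shows "enat k \<le> w_level q (line x w)"
proof -
  have d: "d \<in> normals" using assms(2) by (simp add: normals_def)
  have nz: "d \<noteq> 0" "w \<noteq> 0" 
    using assms(1,2) a_dirs_nonzero Omega_nonzero by (auto simp: w_dirs_def Omega_def)
  note line = line_iff_perp[OF assms(3) nz(2,1)]
  obtain v j where v: "v \<in> qcomp q k" "2 * inner (x - v) d = 2 ^ k * of_int j"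
    using assms(5) by (auto simp: line_level_ge_def pairing_div_def)
  obtain z where z: "z \<in> Qlat" "2 * inner z d = of_int j" using pairing_surj[OF d] by blast
  define p where "p = v + 2 ^ k * z"
  have p: "p \<in> qcomp q k" unfolding p_def using v(1) z(1) by (rule qcomp_add)
  have "2 * inner (p - x) d = 2 ^ k * (2 * inner z d) - 2 * inner (x - v) d"
    by (simp add: p_def inner_add_left inner_diff_left inner_pow2)
  hence px: "inner (p - x) d = 0" using v(2) z(2) by simp
  \<comment> \<open>The two unit lattice vectors at angle 30 degrees from \<open>w\<close>.\<close>
  obtain b c where bc: "b \<in> Qlat" "c \<in> Qlat" "norm b = 1" "norm c = 1" "norm (b - c) = 1" "b + c = 3 * w"
  proof -
    have "norm a\<^sub>1 = 1" "norm a\<^sub>2 = 1" "norm (a\<^sub>1 + a\<^sub>2) = 1"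
      by (rule norm_a_dirs; simp add: a_dirs_def)+
    hence n: "norm a\<^sub>1 = 1" "norm a\<^sub>2 = 1" "norm (a\<^sub>1 + a\<^sub>2) = 1" "norm (- a\<^sub>1) = 1"
      "norm (a\<^sub>1 - (a\<^sub>1 + a\<^sub>2)) = 1" "norm ((a\<^sub>1 + a\<^sub>2) - a\<^sub>2) = 1" "norm (a\<^sub>2 - (- a\<^sub>1)) = 1"
      by (simp_all add: add.commute)
    have s: "a\<^sub>1 + (a\<^sub>1 + a\<^sub>2) = 3 * w\<^sub>1" "(a\<^sub>1 + a\<^sub>2) + a\<^sub>2 = 3 * w\<^sub>2" "a\<^sub>2 + - a\<^sub>1 = 3 * (w\<^sub>2 - w\<^sub>1)"
      by (simp_all add: w\<^sub>1_def w\<^sub>2_def algebra_simps)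
    have l: "a\<^sub>1 + a\<^sub>2 \<in> Qlat" "- a\<^sub>1 \<in> Qlat" by (simp_all add: Qlat_add Qlat_uminus)
    show ?thesis
      using assms(1) that[OF Qlat_a1 l(1) n(1,3,5) ] that[OF l(1) Qlat_a2 n(3,2,6)]
        that[OF Qlat_a2 l(2) n(2,4,7)] s unfolding w_dirs_def by blast
  qed
  define p1 where "p1 = p + 2 ^ k * b"
  define p2 where "p2 = p + 2 ^ k * c"
  have "p1 \<in> qcomp q k" "p2 \<in> qcomp q k"
    unfolding p1_def p2_def using p bc(1,2) by (auto intro: qcomp_add)
  moreover have dist: "dist p p1 = 2 ^ k" "dist p p2 = 2 ^ k" "dist p1 p2 = 2 ^ k"
  proof -
    have "p1 - p2 = 2 ^ k * (b - c)" by (simp add: p1_def p2_def algebra_simps)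
    thus "dist p1 p2 = 2 ^ k" using bc(5) by (simp add: dist_norm norm_mult norm_power)
  qed (use bc in \<open>simp_all add: p1_def p2_def dist_norm norm_mult norm_power\<close>)
  ultimately have T: "{p, p1, p2} \<in> level_triangles q k"
    using p unfolding level_triangles_def by blast
  have "p \<noteq> p1" "p \<noteq> p2" "p1 \<noteq> p2" using dist by auto
  hence "centroid {p, p1, p2} = (p + p1 + p2) / 3"
    by (simp add: centroid_def add.assoc)
  also have "\<dots> = p + 2 ^ k * ((b + c) / 3)" by (simp add: p1_def p2_def field_simps)
  finally have "centroid {p, p1, p2} = p + 2 ^ k * w" by (simp add: bc(6))
  hence "inner (centroid {p, p1, p2} - x) d = inner ((p - x) + 2 ^ k * w) d"
    by (simp add: algebra_simps)
  also have "\<dots> = 0" using px assms(3) by (simp add: inner_add_left inner_pow2)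
  finally have "centroid {p, p1, p2} \<in> line x w" by (simp add: line)
  with T have "k \<in> {k. \<exists>T\<in>level_triangles q k. centroid T \<in> line x w}" by blast
  thus ?thesis unfolding w_level_def by (rule SUP_upper)
qed

lemma generic_imp_level_bounded:
  assumes "generic q" "x \<in> Qlat" "u \<in> normals"
  shows "\<exists>k. \<not> line_level_ge q k u x"
proof (cases "u \<in> Omega")
  case True
  have "\<exists>d\<in>a_dirs. inner u d = 0"
    using True unfolding a_dirs_eq Omega_eq
    by (elim insertE emptyE; simp add: inner_complex_def)
  then obtain d where d: "d \<in> a_dirs" "inner u d = 0" by blast
  show ?thesis
    using a_level_infinite_iff[OF d(1) True d(2) assms(2)] assms(1,2) d(1)
    unfolding generic_def by blast
next
  case False
  hence d: "u \<in> a_dirs" using assms(3) by (simp add: normals_def)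
  have "\<exists>w\<in>w_dirs. inner w u = 0"
    using d unfolding a_dirs_def w_dirs_def
    by (elim insertE emptyE; simp add: inner_complex_def vector_eqs)
  then obtain w where w: "w \<in> w_dirs" "inner w u = 0" by blast
  have "w_level q (line x w) \<noteq> \<infinity>" using assms(1,2) w(1) unfolding generic_def by blast
  then obtain n where "w_level q (line x w) = enat n" by auto
  hence "\<not> enat (Suc n) \<le> w_level q (line x w)" by simp
  thus ?thesis using w_level_ge[OF w(1) d w(2) assms(2)] by blast
qed

section \<open>Stripes are determined by congruences\<close>

lemma Omega_perp_ex:
  assumes "w \<in> Omega" shows "\<exists>d\<in>a_dirs. inner w d = 0"
  using assms unfolding a_dirs_eq Omega_eq
  by (elim insertE emptyE; simp add: inner_complex_def)

lemma line_inj: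
  assumes "b \<in> a_dirs" "c \<in> a_dirs" "line y b = line y c"
  shows "b = c"
proof -
  have "y + of_real 1 * b \<in> line y b" unfolding line_def by blast
  hence in_c: "y + b \<in> line y c" using assms(3) by simp
  obtain w where w: "w \<in> Omega" "inner w c = 0" using a_dirs_perp_ex[OF assms(2)] by blast
  have "inner w b = 0"
    using in_c line_iff_perp[of c w "y + b" y] w a_dirs_nonzero[OF assms(2)] Omega_nonzero[OF w(1)]
    by (simp add: inner_commute)
  thus ?thesis using a_dirs_perp_unique[OF w(1) assms(1,2) _ w(2)] by simp
qed

lemma level_edge_on_lineE:
  assumes "e \<in> level_edges q k" "e \<subseteq> line x d" "d \<in> a_dirs"
  obtains p where "p \<in> qcomp q k" "p + 2 ^ k * d \<in> qcomp q k" "e = closed_segment p (p + 2 ^ k * d)"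
proof -
  obtain u v where uv: "u \<in> qcomp q k" "v \<in> qcomp q k" "dist u v = 2 ^ k" "e = closed_segment u v"
    using assms(1) by (auto simp: level_edges_def)
  have "u \<in> line x d" "v \<in> line x d" using uv(4) assms(2) by auto
  then obtain s t where st: "u = x + of_real s * d" "v = x + of_real t * d"
    unfolding line_def by blast
  have "u - v = of_real (s - t) * d" using st by (simp add: algebra_simps)
  hence "\<bar>s - t\<bar> = 2 ^ k"
    using uv(3) norm_a_dirs[OF assms(3)] by (simp add: dist_norm norm_mult del: of_real_diff)
  hence "t = s + 2 ^ k \<or> s = t + 2 ^ k" by (auto simp: abs_if split: if_splits)
  thus ?thesis
  proof
    assume "t = s + 2 ^ k"
    hence "v = u + 2 ^ k * d" using st by (simp add: algebra_simps)
    with uv that[of u] show ?thesis by simp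
  next
    assume "s = t + 2 ^ k"
    hence "u = v + 2 ^ k * d" using st by (simp add: algebra_simps)
    with uv that[of v] show ?thesis by (simp add: closed_segment_commute)
  qed
qed

lemma segment_interior_pointE:
  assumes "x \<in> closed_segment p (p + b)" "x \<noteq> p" "x \<noteq> p + b"
  obtains s where "0 < s" "s < 1" "x = p + of_real s * b"
proof -
  obtain s where s: "0 \<le> s" "s \<le> 1" "x = (1 - s) *\<^sub>R p + s *\<^sub>R (p + b)"
    using assms(1) by (auto simp: closed_segment_def)
  hence x: "x = p + of_real s * b" by (simp add: algebra_simps scaleR_conv_of_real)
  with assms(2,3) have "s \<noteq> 0" "s \<noteq> 1" by auto
  with s(1,2) have "0 < s" "s < 1" by simp_all
  thus ?thesis using x by (rule that)
qed

text \<open>An edge through \<open>x\<close> in a given direction, \<open>x\<close> not being one of its ends, is unique: the starting points of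
two such edges differ by less than \<open>2\<^sup>k\<close>.  This form allows \<open>x\<close> to be moved by a vector of \<open>2\<^sup>k Q\<close>.\<close>

lemma level_edges_congruent:
  assumes "p \<in> qcomp q k" "p' \<in> qcomp q k" "d \<in> a_dirs"
    and "x \<in> closed_segment p (p + 2 ^ k * d)" "x' \<in> closed_segment p' (p' + 2 ^ k * d)"
    and "x \<notin> qcomp q k" "x' \<in> Qcoset k x"
  shows "p' - p = x' - x"
proof -
  have ends: "p + 2 ^ k * d \<in> qcomp q k" "p' + 2 ^ k * d \<in> qcomp q k"
    using assms(1-3) by (auto intro: qcomp_add a_dirs_Qlat)
  have x': "x' \<notin> qcomp q k"
  proof
    assume "x' \<in> qcomp q k"
    hence "qcomp q k = Qcoset k x'" by (rule qcomp_eq)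
    with Qcoset_sym[OF assms(7)] assms(6) show False by simp
  qed
  obtain s where s: "0 < s" "s < 1" "x = p + of_real s * (2 ^ k * d)"
    using segment_interior_pointE[OF assms(4)] assms(1,6) ends by metis
  obtain s' where s': "0 < s'" "s' < 1" "x' = p' + of_real s' * (2 ^ k * d)"
    using segment_interior_pointE[OF assms(5)] assms(2) x' ends by metis
  obtain y where y: "y \<in> Qlat" "x' - x = 2 ^ k * y" using assms(7) by (auto simp: Qcoset_iff)
  obtain z where z: "z \<in> Qlat" "p' - p = 2 ^ k * z" using qcomp_diff[OF assms(2,1)] by blast
  have "2 ^ k * (z - y) = (p' - p) - (x' - x)" using y z by (simp add: algebra_simps)
  also have "\<dots> = 2 ^ k * (of_real (s - s') * d)" using s(3) s'(3) by (simp add: algebra_simps)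
  finally have zy: "z - y = of_real (s - s') * d" by simp
  have "norm (z - y) = \<bar>s - s'\<bar>"
    unfolding zy using norm_a_dirs[OF assms(3)] by (simp add: norm_mult del: of_real_diff)
  also have "\<dots> < 1" using s s' by linarith
  finally have "z - y = 0" using norm_Qlat_ge_1[OF Qlat_diff[OF z(1) y(1)]] by force
  with y z show ?thesis by simp
qed

text \<open>Over an edge of length \<open>2\<^sup>k\<close> there are two equilateral apexes, but only one lies in a given coset of
\<open>2\<^sup>k\<^sup>+\<^sup>1 Q\<close>.  Points of that coset are at least \<open>2 * 2\<^sup>k\<close> apart, so by equality in the triangle inequality both
ends of the edge would be the midpoint of two distinct apexes.\<close>

lemma apex_unique:
  assumes "u \<in> Qcoset (Suc k) u'" "p \<noteq> p'"
    and "dist u p = 2 ^ k" "dist u p' = 2 ^ k" "dist u' p = 2 ^ k" "dist u' p' = 2 ^ k"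
  shows "u = u'"
proof (rule ccontr)
  assume "u \<noteq> u'"
  obtain z where z: "z \<in> Qlat" "u - u' = 2 ^ Suc k * z" using assms(1) by (auto simp: Qcoset_iff)
  with \<open>u \<noteq> u'\<close> have "1 \<le> norm z" using norm_Qlat_ge_1 by force
  hence far: "2 ^ k + 2 ^ k \<le> norm (u - u')"
    unfolding z by (simp add: norm_mult norm_power)
  have mid: "u - r = r - u'" if r: "dist u r = 2 ^ k" "dist u' r = 2 ^ k" for r
  proof -
    have n: "norm (u - r) = 2 ^ k" "norm (r - u') = 2 ^ k"
      using r by (simp_all add: dist_norm norm_minus_commute)
    have "norm ((u - r) + (r - u')) = norm (u - r) + norm (r - u')"
      using far n norm_triangle_ineq[of "u - r" "r - u'"] by simp
    hence "norm (u - r) *\<^sub>R (r - u') = norm (r - u') *\<^sub>R (u - r)" by (simp only: norm_triangle_eq)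
    thus ?thesis using n by simp
  qed
  have "2 * p = u + u'" "2 * p' = u + u'"
    using mid[OF assms(3,5)] mid[OF assms(4,6)] by (simp_all add: algebra_simps)
  with assms(2) show False by (metis mult_cancel_left zero_neq_numeral)
qed

text \<open>The triangle with midsegment \<open>p p'\<close> is determined by its vertex \<open>u\<close> common to the two bisected sides: the
others are \<open>2 * p - u\<close> and \<open>2 * p' - u\<close>.\<close>

lemma midsegment_triangleE:
  assumes "T \<in> level_triangles q (Suc k)" "is_midsegment (closed_segment p p') T"
  obtains u where "u \<in> qcomp q (Suc k)" "dist u p = 2 ^ k" "dist u p' = 2 ^ k"
    "centroid T = (2 * p + 2 * p' - u) / 3"
proof -
  obtain u v w where T: "T = {u, v, w}" "u \<noteq> v" "v \<noteq> w" "u \<noteq> w"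
    and seg: "closed_segment p p' = closed_segment (midpoint u v) (midpoint u w)"
    using assms(2) by (auto simp: is_midsegment_def)
  have sub: "T \<subseteq> qcomp q (Suc k)" using assms(1) by (auto simp: level_triangles_def)
  have "dist a b = 2 ^ Suc k" if "a \<in> T" "b \<in> T" "a \<noteq> b" for a b
    using assms(1) that by (auto simp: level_triangles_def dist_commute)
  hence d: "dist u (midpoint u v) = 2 ^ k" "dist u (midpoint u w) = 2 ^ k"
    using T by (auto simp: dist_midpoint)
  have c: "centroid T = (2 * midpoint u v + 2 * midpoint u w - u) / 3"
  proof -
    have "2 * midpoint u b = u + b" for b
      by (simp add: midpoint_def scaleR_conv_of_real)
    thus ?thesis using T by (simp add: centroid_def algebra_simps)
  qed
  have "{p, p'} = {midpoint u v, midpoint u w}" using seg by (simp add: closed_segment_eq)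
  hence "p = midpoint u v \<and> p' = midpoint u w \<or> p = midpoint u w \<and> p' = midpoint u v"
    by (auto simp: doubleton_eq_iff)
  thus ?thesis using that[of u] sub T(1) d c by (auto simp: add.commute)
qed

text \<open>Consequently the vector from \<open>x\<close> to the centroid, towards which the stripe is displaced, depends on \<open>x\<close>
modulo \<open>2\<^sup>k\<^sup>+\<^sup>1 Q\<close> only.\<close>

lemma midsegment_centroid_congruent:
  assumes edges: "e \<in> level_edges q k" "e' \<in> level_edges q k"
    and lines: "x \<in> e" "e \<subseteq> line x d" "x' \<in> e'" "e' \<subseteq> line x' d" "d \<in> a_dirs"
    and triangles: "T \<in> level_triangles q (Suc k)" "T' \<in> level_triangles q (Suc k)"
    and mid: "is_midsegment e T" "is_midsegment e' T'"
    and x: "x \<notin> qcomp q k" "x' \<in> Qcoset (Suc k) x"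
  shows "centroid T' - x' = centroid T - x"
proof -
  obtain p where p: "p \<in> qcomp q k" "e = closed_segment p (p + 2 ^ k * d)"
    using level_edge_on_lineE[OF edges(1) lines(2,5)] by metis
  obtain p' where p': "p' \<in> qcomp q k" "e' = closed_segment p' (p' + 2 ^ k * d)"
    using level_edge_on_lineE[OF edges(2) lines(4,5)] by metis
  have "x' \<in> Qcoset k x" using x(2) Qcoset_Suc by blast
  hence shift: "p' = p + (x' - x)"
    using level_edges_congruent[OF p(1) p'(1) lines(5) _ _ x(1)] lines(1,3) p(2) p'(2)
    by (simp add: algebra_simps)
  obtain u where u: "u \<in> qcomp q (Suc k)" "dist u p = 2 ^ k" "dist u (p + 2 ^ k * d) = 2 ^ k"
    "centroid T = (2 * p + 2 * (p + 2 ^ k * d) - u) / 3"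
    using midsegment_triangleE[OF triangles(1) mid(1)[unfolded p(2)]] by metis
  obtain u' where u': "u' \<in> qcomp q (Suc k)" "dist u' p' = 2 ^ k" "dist u' (p' + 2 ^ k * d) = 2 ^ k"
    "centroid T' = (2 * p' + 2 * (p' + 2 ^ k * d) - u') / 3"
    using midsegment_triangleE[OF triangles(2) mid(2)[unfolded p'(2)]] by metis
  have "u' - (x' - x) = u"
  proof (rule apex_unique)
    obtain y where y: "y \<in> Qlat" "x' - x = 2 ^ Suc k * y" using x(2) by (auto simp: Qcoset_iff)
    obtain z where z: "z \<in> Qlat" "u' - u = 2 ^ Suc k * z" using qcomp_diff[OF u'(1) u(1)] by blast
    have "u' - (x' - x) - u = 2 ^ Suc k * (z - y)" using y z by (simp add: algebra_simps)
    thus "u' - (x' - x) \<in> Qcoset (Suc k) u" unfolding Qcoset_iff using y(1) z(1) Qlat_diff by blast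
    show "p \<noteq> p + 2 ^ k * d" using a_dirs_nonzero[OF lines(5)] by simp
    show "dist (u' - (x' - x)) p = 2 ^ k" "dist (u' - (x' - x)) (p + 2 ^ k * d) = 2 ^ k"
      using u'(2,3) unfolding shift by (simp_all add: dist_norm algebra_simps)
  qed (use u in simp_all)
  hence shift_u: "u' = u + (x' - x)" by (simp add: algebra_simps)
  show ?thesis unfolding u u' shift shift_u by (simp add: field_simps)
qed

text \<open>What is used of a generic Taylor--Socolar tiling: the shape of the tiles, the colour rule, and the
description of the stripes by \<open>q\<close>.\<close>

locale generic_tiling =
  fixes \<Lambda> :: tiling and q :: qbar
  assumes valid: "x \<in> Qlat \<Longrightarrow> valid_tile (\<Lambda> x)"
    and colour_rule: "rule2 \<Lambda>"
    and xi: "is_xi \<Lambda> q"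
    and generic: "generic q"
begin

lemma stripe_dir_in: "x \<in> Qlat \<Longrightarrow> stripe_dir (\<Lambda> x) \<in> a_dirs"
  using valid by (simp add: valid_tile_def)

lemma stripe_side_in: "x \<in> Qlat \<Longrightarrow> stripe_side (\<Lambda> x) \<in> Omega"
  using valid by (simp add: valid_tile_def)

lemma stripe_side_perp: "x \<in> Qlat \<Longrightarrow> inner (stripe_side (\<Lambda> x)) (stripe_dir (\<Lambda> x)) = 0"
  using valid by (simp add: valid_tile_def)

lemma a_level_finite: "x \<in> Qlat \<Longrightarrow> d \<in> a_dirs \<Longrightarrow> a_level q (line x d) \<noteq> \<infinity>"
  using generic by (simp add: generic_def)

lemma stripe_dir_maximal:
  assumes "x \<in> Qlat" "d \<in> a_dirs" "line x d \<noteq> line x (stripe_dir (\<Lambda> x))"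
  shows "a_level q (line x d) < a_level q (line x (stripe_dir (\<Lambda> x)))"
proof -
  have "\<not> (\<forall>d\<in>a_dirs. a_level q (line x d) = \<infinity>)"
    using a_level_finite assms(1,2) by blast
  thus ?thesis using xi assms unfolding is_xi_def Let_def by blast
qed

lemma stripe_side_triangle:
  assumes "x \<in> Qlat" "a_level q (line x (stripe_dir (\<Lambda> x))) = enat k"
  shows "\<exists>e\<in>level_edges q k. \<exists>T\<in>level_triangles q (Suc k). x \<in> e \<and> e \<subseteq> line x (stripe_dir (\<Lambda> x)) \<and>
    is_midsegment e T \<and> inner (stripe_side (\<Lambda> x)) (centroid T - x) > 0"
proof -
  have "\<not> (\<forall>d\<in>a_dirs. a_level q (line x d) = \<infinity>)"
    using a_level_finite assms(1) stripe_dir_in by blast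
  thus ?thesis using xi assms unfolding is_xi_def Let_def by blast
qed

lemma stripe_dir_not_lower:
  assumes "x \<in> Qlat" "w \<in> Omega" "w' \<in> Omega"
    and "\<not> line_level_ge q k w x" "line_level_ge q k w' x"
  shows "inner w (stripe_dir (\<Lambda> x)) \<noteq> 0"
proof
  assume perp: "inner w (stripe_dir (\<Lambda> x)) = 0"
  obtain d' where d': "d' \<in> a_dirs" "inner w' d' = 0" using Omega_perp_ex[OF assms(3)] by blast
  have "\<not> enat k \<le> a_level q (line x (stripe_dir (\<Lambda> x)))"
    using a_level_ge_iff[OF stripe_dir_in[OF assms(1)] assms(2) perp assms(1)] assms(4) by simp
  moreover have "enat k \<le> a_level q (line x d')"
    using a_level_ge_iff[OF d'(1) assms(3) d'(2) assms(1)] assms(5) by simp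
  ultimately have "\<not> a_level q (line x d') \<le> a_level q (line x (stripe_dir (\<Lambda> x)))"
    using order_trans by blast
  thus False using stripe_dir_maximal[OF assms(1) d'(1)] by fastforce
qed

text \<open>If \<open>K\<close> exceeds the levels of the three a-lines through \<open>x\<close>, then these levels, and hence the direction of
the line of largest level, are determined by \<open>x\<close> modulo \<open>2 ^ K\<close>.\<close>

lemma stripe_dir_cong:
  assumes "x \<in> Qlat" "x' \<in> Qlat" "x' \<in> Qcoset K x"
    and low: "\<And>w. w \<in> Omega \<Longrightarrow> \<not> line_level_ge q K w x"
  shows "stripe_dir (\<Lambda> x') = stripe_dir (\<Lambda> x)"
proof -
  have P: "line_level_ge q k w x' \<longleftrightarrow> line_level_ge q k w x" if w: "w \<in> Omega" for k w
  proof -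
    have wn: "w \<in> normals" using w by (simp add: normals_def)
    show ?thesis
    proof (cases "k \<le> K")
      case True
      hence "x' \<in> Qcoset k x" using Qcoset_mono assms(3) by blast
      thus ?thesis by (rule line_level_ge_cong[OF wn])
    next
      case False
      hence "K \<le> k" by simp
      thus ?thesis using line_level_ge_mono[OF \<open>K \<le> k\<close>] low[OF w]
          line_level_ge_cong[OF wn assms(3)] by blast
    qed
  qed
  have lv: "a_level q (line x' d) = a_level q (line x d)" if d: "d \<in> a_dirs" for d
  proof -
    obtain w where w: "w \<in> Omega" "inner w d = 0" using a_dirs_perp_ex[OF d] by blast
    have "enat k \<le> a_level q (line x' d) \<longleftrightarrow> enat k \<le> a_level q (line x d)" for k
      using a_level_ge_iff[OF d w assms(1)] a_level_ge_iff[OF d w assms(2)] P[OF w(1)] by simp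
    moreover obtain i j where "a_level q (line x' d) = enat i" "a_level q (line x d) = enat j"
      using a_level_finite[OF assms(1) d] a_level_finite[OF assms(2) d] by blast
    ultimately show ?thesis by (metis enat_ord_simps(1) order_antisym order_refl)
  qed
  let ?d = "stripe_dir (\<Lambda> x)" and ?d' = "stripe_dir (\<Lambda> x')"
  have d: "?d \<in> a_dirs" "?d' \<in> a_dirs" using assms(1,2) stripe_dir_in by auto
  show ?thesis
  proof (rule ccontr)
    assume neq: "?d' \<noteq> ?d"
    have "a_level q (line x ?d') < a_level q (line x ?d)"
      using stripe_dir_maximal[OF assms(1) d(2)] line_inj d neq by blast
    moreover have "a_level q (line x' ?d) < a_level q (line x' ?d')"
      using stripe_dir_maximal[OF assms(2) d(1)] line_inj d neq by metis
    ultimately show False using lv d by (simp add: less_le_not_le)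
  qed
qed

text \<open>The point \<open>x\<close> is interior to an edge of level \<open>k < K\<close>: were it a level-\<open>k\<close> vertex, all a-lines through \<open>x\<close>
would have level at least \<open>k\<close>, but two of them have smaller level.  So
\<open>midsegment_centroid_congruent\<close> applies, as the side is that of the centroid of a triangle of level
\<open>k + 1 \<le> K\<close>.\<close>

lemma stripe_side_cong:
  assumes "x \<in> Qlat" "x' \<in> Qlat" "x' \<in> Qcoset K x"
    and low: "\<And>w. w \<in> Omega \<Longrightarrow> \<not> line_level_ge q K w x"
  shows "stripe_side (\<Lambda> x') = stripe_side (\<Lambda> x)"
proof -
  define d where "d = stripe_dir (\<Lambda> x)"
  have d': "stripe_dir (\<Lambda> x') = d" unfolding d_def using assms by (rule stripe_dir_cong)
  have d: "d \<in> a_dirs" unfolding d_def using assms(1) by (rule stripe_dir_in)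
  let ?s = "stripe_side (\<Lambda> x)" and ?s' = "stripe_side (\<Lambda> x')"
  have s: "?s \<in> Omega" "inner ?s d = 0" "?s' \<in> Omega" "inner ?s' d = 0"
    using stripe_side_in stripe_side_perp assms(1,2) d' unfolding d_def by metis+
  have sn: "?s \<in> normals" using s by (simp add: normals_def)
  obtain k where k: "a_level q (line x d) = enat k" using a_level_finite[OF assms(1) d] by blast
  have lev: "enat j \<le> a_level q (line x d) \<longleftrightarrow> line_level_ge q j ?s x" for j
    using a_level_ge_iff[OF d s(1,2) assms(1)] .
  hence "\<not> K \<le> k" using low[OF s(1)] k by auto
  hence kK: "Suc k \<le> K" by simp
  have cong: "x' \<in> Qcoset (Suc k) x" using Qcoset_mono[OF kK] assms(3) by blast
  have lev': "enat j \<le> a_level q (line x' d) \<longleftrightarrow> line_level_ge q j ?s x'" for j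
    using a_level_ge_iff[OF d s(1,2) assms(2)] .
  have "line_level_ge q k ?s x'"
    using lev[of k] k line_level_ge_cong[OF sn, of x' k x] cong Qcoset_Suc by auto
  moreover have "\<not> line_level_ge q (Suc k) ?s x'"
    using lev[of "Suc k"] k line_level_ge_cong[OF sn cong] by simp
  ultimately have "enat k \<le> a_level q (line x' d)" "\<not> enat (Suc k) \<le> a_level q (line x' d)"
    using lev' by blast+
  hence k': "a_level q (line x' d) = enat k" by (cases "a_level q (line x' d)") auto
  have "\<exists>w\<in>Omega. inner w d \<noteq> 0"
    using d unfolding a_dirs_eq Omega_eq by (elim insertE emptyE; simp add: inner_complex_def)
  then obtain w where w: "w \<in> Omega" "inner w d \<noteq> 0" by blast
  obtain b where b: "b \<in> a_dirs" "inner w b = 0" using Omega_perp_ex[OF w(1)] by blast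
  have "\<not> enat k \<le> a_level q (line x b)"
  proof -
    have "b \<noteq> d" using b w by blast
    have "line x b \<noteq> line x d" using line_inj b(1) d \<open>b \<noteq> d\<close> by blast
    hence "a_level q (line x b) < enat k"
      using stripe_dir_maximal[OF assms(1) b(1)] k unfolding d_def by simp
    thus ?thesis by simp
  qed
  hence xq: "x \<notin> qcomp q k"
    using a_level_ge_iff[OF b(1) w(1) b(2) assms(1)] line_level_ge_vertex by blast
  obtain e T where e: "e \<in> level_edges q k" "T \<in> level_triangles q (Suc k)" "x \<in> e" "e \<subseteq> line x d"
    "is_midsegment e T" "inner ?s (centroid T - x) > 0"
    using stripe_side_triangle[OF assms(1)] k unfolding d_def by blast
  obtain e' T' where e': "e' \<in> level_edges q k" "T' \<in> level_triangles q (Suc k)" "x' \<in> e'"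
    "e' \<subseteq> line x' d" "is_midsegment e' T'" "inner ?s' (centroid T' - x') > 0"
    using stripe_side_triangle[OF assms(2)] k' unfolding d' by blast
  have "centroid T' - x' = centroid T - x"
    by (rule midsegment_centroid_congruent[OF e(1) e'(1) e(3,4) e'(3,4) d e(2) e'(2) e(5) e'(5) xq cong])
  hence "inner ?s' (centroid T - x) > 0" using e'(6) by simp
  hence "?s' \<noteq> - ?s" using e(6) by auto
  thus ?thesis using Omega_perp_unique[OF s(1,3) d s(2,4)] by blast
qed

end

section \<open>Colours travel along w-lines\<close>

lemma mem_line_0_iff:
  assumes "e \<noteq> 0" shows "w \<in> line 0 e \<longleftrightarrow> inner w (\<i> * e) = 0"
  using line_iff_perp[of e "\<i> * e" w 0] assms by (simp add: inner_complex_def)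

lemma cis_pi_sixth: "cis (pi / 6) = Complex (sqrt 3 / 2) (1 / 2)"
  "cis (- pi / 6) = Complex (sqrt 3 / 2) (- 1 / 2)"
  by (simp_all add: complex_eq_iff cos_30 sin_30)

text \<open>The diagonals of fixed colour are those not perpendicular to the stripe.  With \<open>A\<close> and \<open>B\<close> the components
of \<open>w\<close> along \<open>d\<close> and across it, \<open>w\<close> lies on one of them iff \<open>3 * B\<^sup>2 = A\<^sup>2\<close>, and \<open>A\<^sup>2 + B\<^sup>2 = 1 / 3\<close>.\<close>

lemma mem_coloured_diagonal_iff:
  assumes "d \<in> a_dirs" "w \<in> Omega"
  shows "w \<in> line 0 (d * cis (- pi / 6)) \<or> w \<in> line 0 (d * cis (pi / 6)) \<longleftrightarrow> inner w d \<noteq> 0"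
proof -
  have nz: "d * cis (- pi / 6) \<noteq> 0" "d * cis (pi / 6) \<noteq> 0"
    using a_dirs_nonzero[OF assms(1)] by simp_all
  define A where "A = inner w d"
  define B where "B = inner w (\<i> * d)"
  have rot: "inner w (\<i> * (d * cis (pi / 6))) = (sqrt 3 * B - A) / 2"
    "inner w (\<i> * (d * cis (- pi / 6))) = (sqrt 3 * B + A) / 2"
    unfolding cis_pi_sixth A_def B_def
    by (simp_all add: inner_complex_def field_simps)
  have "A\<^sup>2 + B\<^sup>2 = (norm w)\<^sup>2 * (norm d)\<^sup>2"
    unfolding A_def B_def cmod_power2 by (simp add: inner_complex_def power2_eq_square algebra_simps)
  hence pyth: "3 * B\<^sup>2 = 1 - 3 * A\<^sup>2"
    using norm_Omega[OF assms(2)] norm_a_dirs[OF assms(1)] by simp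
  have "A = 0 \<or> A * A = 1 / 4"
    using assms unfolding A_def a_dirs_eq Omega_eq
    by (elim insertE emptyE; simp add: inner_complex_def)
  hence "A\<^sup>2 = 1 / 4 \<longleftrightarrow> A \<noteq> 0" by (auto simp: power2_eq_square)
  moreover have "(sqrt 3 * B - A) * (sqrt 3 * B + A) = 3 * B\<^sup>2 - A\<^sup>2"
    by (simp add: algebra_simps power2_eq_square)
  ultimately have "(sqrt 3 * B - A) * (sqrt 3 * B + A) = 0 \<longleftrightarrow> A \<noteq> 0"
    unfolding pyth by auto
  thus ?thesis
    unfolding mem_line_0_iff[OF nz(1)] mem_line_0_iff[OF nz(2)] rot mult_eq_0_iff A_def [symmetric]
    by auto
qed

lemma half_colour_oblique:
  assumes "stripe_dir t \<in> a_dirs" "w \<in> Omega" "inner w (stripe_dir t) \<noteq> 0"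
  shows "half_colour t w = (if w \<in> line 0 (stripe_dir t * cis (- pi / 6)) then Red else Blue)"
  using mem_coloured_diagonal_iff[OF assms(1,2)] assms(3) by (auto simp: half_colour_def)

lemma half_colour_perp:
  assumes "stripe_dir t \<in> a_dirs" "w \<in> Omega" "inner w (stripe_dir t) = 0"
  shows "half_colour t w = (if w = red_end t then Red else Blue)"
  using mem_coloured_diagonal_iff[OF assms(1,2)] assms(3) by (auto simp: half_colour_def)

text \<open>A diagonal oblique to the stripe is coloured as a line through the centre, so its ends agree.  The ends of
the perpendicular one are \<open>red_end t\<close> and its opposite.\<close>

lemma half_colour_uminus:
  assumes "valid_tile t" "w \<in> Omega"
  shows "half_colour t (- w) = half_colour t w \<longleftrightarrow> inner w (stripe_dir t) \<noteq> 0"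
proof -
  have d: "stripe_dir t \<in> a_dirs" and r: "red_end t \<in> Omega" "inner (red_end t) (stripe_dir t) = 0"
    using assms(1) by (simp_all add: valid_tile_def)
  note w' = Omega_uminus[OF assms(2)]
  show ?thesis
  proof (cases "inner w (stripe_dir t) = 0")
    case True
    hence "red_end t = w \<or> red_end t = - w" using Omega_perp_unique[OF assms(2) r(1) d True r(2)] by simp
    moreover have "w \<noteq> - w" using Omega_nonzero[OF assms(2)] by simp
    ultimately show ?thesis
      using half_colour_perp[OF d assms(2) True] half_colour_perp[OF d w'] True by auto
  next
    case False
    have "- w \<in> line 0 e \<longleftrightarrow> w \<in> line 0 e" if "e \<noteq> 0" for e
      by (simp add: mem_line_0_iff[OF that])
    hence "- w \<in> line 0 (stripe_dir t * cis (- pi / 6)) \<longleftrightarrow> w \<in> line 0 (stripe_dir t * cis (- pi / 6))"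
      using a_dirs_nonzero[OF d] by simp
    thus ?thesis
      using half_colour_oblique[OF d assms(2) False] half_colour_oblique[OF d w'] False by simp
  qed
qed

lemma colour_neq_imp_eq: "(a :: colour) \<noteq> c \<Longrightarrow> b \<noteq> c \<Longrightarrow> a = b"
  by (cases a; cases b; cases c) simp_all

text \<open>The stripe is at distance \<open>\<epsilon>\<close> from the centre, and \<open>\<epsilon> \<le> 1 / 4 < 1 / sqrt 3\<close>, the length of a half diagonal.
So it crosses the half diagonal on its own side and misses the opposite one: white and gray are the two
values of the colour of the half diagonal to which the stripe is displaced.\<close>

lemma stripe_crosses_iff:
  assumes "valid_tile t" "0 < \<epsilon>" "\<epsilon> \<le> 1 / 4"
  shows "stripe_crosses \<epsilon> t x c \<longleftrightarrow> half_colour t (stripe_side t) = c"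
proof -
  let ?s = "stripe_side t" and ?d = "stripe_dir t"
  have d: "?d \<in> a_dirs" and s: "?s \<in> Omega" "inner ?s ?d = 0"
    using assms(1) by (simp_all add: valid_tile_def)
  have ns: "norm ?s = sqrt (1 / 3)" using norm_Omega[OF s(1)] .
  have "\<epsilon> \<le> sqrt (1 / 3)"
    by (rule real_le_rsqrt) (use assms(2,3) power_mono[of \<epsilon> "1 / 4" 2] in \<open>simp add: power2_eq_square\<close>)
  hence \<epsilon>: "\<epsilon> \<le> norm ?s" using ns by simp
  have nz: "0 < norm ?s" using Omega_nonzero[OF s(1)] by simp
  let ?c = "x + of_real \<epsilon> * sgn ?s"
  have c: "?c = x + (\<epsilon> / norm ?s) *\<^sub>R ?s"
    by (simp add: sgn_div_norm scaleR_conv_of_real divide_inverse)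
  have stripe_height: "inner (y - x) ?s = \<epsilon> * norm ?s" if "y \<in> stripe \<epsilon> t x" for y
  proof -
    obtain r where "y = (1 - r) *\<^sub>R (?c - ?d / 2) + r *\<^sub>R (?c + ?d / 2)"
      using \<open>y \<in> stripe \<epsilon> t x\<close> unfolding stripe_def Let_def closed_segment_def by blast
    moreover have "(1 - r) *\<^sub>R (b - e) + r *\<^sub>R (b + e) = b + (2 * r - 1) *\<^sub>R e" for b e :: complex
      by (simp add: algebra_simps scaleR_conv_of_real)
    ultimately have "y = ?c + (2 * r - 1) *\<^sub>R (?d / 2)" by metis
    hence "y - x = (\<epsilon> / norm ?s) *\<^sub>R ?s + ((2 * r - 1) / 2) *\<^sub>R ?d"
      unfolding c by (simp add: scaleR_conv_of_real)
    hence "inner (y - x) ?s = (\<epsilon> / norm ?s) * (norm ?s)\<^sup>2"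
      using s(2) by (simp add: inner_add_left inner_commute [of ?d] power2_norm_eq_inner)
    thus ?thesis by (simp add: power2_eq_square)
  qed
  have "?c \<in> stripe \<epsilon> t x"
    unfolding stripe_def Let_def closed_segment_def
    by (intro CollectI exI[of _ "1 / 2"]) (simp add: algebra_simps scaleR_conv_of_real)
  moreover have "?c \<in> closed_segment x (x + ?s)"
    unfolding c closed_segment_def
    by (intro CollectI exI[of _ "\<epsilon> / norm ?s"]) (use \<epsilon> nz assms(2) in \<open>simp add: algebra_simps\<close>)
  ultimately have meets: "stripe \<epsilon> t x \<inter> closed_segment x (x + ?s) \<noteq> {}" by blast
  have misses: "stripe \<epsilon> t x \<inter> closed_segment x (x + - ?s) = {}"
  proof -
    have False if y: "y \<in> stripe \<epsilon> t x" "y \<in> closed_segment x (x + - ?s)" for y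
    proof -
      obtain r where "0 \<le> r" "y = (1 - r) *\<^sub>R x + r *\<^sub>R (x + - ?s)"
        using y(2) unfolding closed_segment_def by blast
      hence "y - x = - r *\<^sub>R ?s" by (simp add: algebra_simps)
      hence "inner (y - x) ?s \<le> 0" using \<open>0 \<le> r\<close> by (simp add: mult_nonneg_nonneg)
      moreover have "\<epsilon> * norm ?s > 0" using assms(2) nz by simp
      ultimately show False using stripe_height[OF y(1)] by simp
    qed
    thus ?thesis by blast
  qed
  show ?thesis
  proof
    assume "stripe_crosses \<epsilon> t x c"
    then obtain w where w: "w \<in> Omega" "inner w ?d = 0" "half_colour t w = c"
      "stripe \<epsilon> t x \<inter> closed_segment x (x + w) \<noteq> {}"
      unfolding stripe_crosses_def by blast
    hence "w = ?s" using Omega_perp_unique[OF s(1) w(1) d s(2) w(2)] misses by blast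
    with w show "half_colour t ?s = c" by simp
  next
    assume "half_colour t ?s = c"
    thus "stripe_crosses \<epsilon> t x c" unfolding stripe_crosses_def using s meets by blast
  qed
qed

definition colour_at :: "tiling \<Rightarrow> complex \<Rightarrow> colour" where
  "colour_at \<Lambda> x = half_colour (\<Lambda> x) (stripe_side (\<Lambda> x))"

context generic_tiling
begin

text \<open>The colour rule and \<open>half_colour_uminus\<close> carry the colour at the end \<open>s\<close> of the diagonal from the tile at
\<open>x + 3 * s\<close> to the tile at \<open>x\<close>, flipping it or not according to the stripe direction at \<open>x + 3 * s\<close>.  At a tile
whose stripe is not perpendicular to \<open>s\<close> the stripe direction alone fixes the colour.  Hence stripe
directions along the w-line, up to such a tile, determine the colour at \<open>x\<close>.\<close>

lemma half_colour_propagates: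
  assumes s: "s \<in> Omega" and "x \<in> Qlat" "x' \<in> Qlat"
    and "\<And>n. n \<le> N \<Longrightarrow> stripe_dir (\<Lambda> (x' + of_nat n * (3 * s))) = stripe_dir (\<Lambda> (x + of_nat n * (3 * s)))"
    and "inner s (stripe_dir (\<Lambda> (x + of_nat N * (3 * s)))) \<noteq> 0"
  shows "half_colour (\<Lambda> x') s = half_colour (\<Lambda> x) s"
  using assms(2-)
proof (induction N arbitrary: x x')
  case 0
  thus ?case using half_colour_oblique[OF stripe_dir_in s] by simp
next
  case (Suc N)
  let ?y = "x + 3 * s" and ?y' = "x' + 3 * s"
  have step: "b + of_nat (Suc n) * (3 * s) = (b + 3 * s) + of_nat n * (3 * s)" for b n
    by (simp add: algebra_simps)
  have y: "?y \<in> Qlat" "?y' \<in> Qlat" using Suc.prems(1,2) triple_Omega_Qlat[OF s] by (simp_all add: Qlat_add)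
  have dirs: "stripe_dir (\<Lambda> (?y' + of_nat n * (3 * s))) = stripe_dir (\<Lambda> (?y + of_nat n * (3 * s)))"
    if "n \<le> N" for n
    using Suc.prems(3)[of "Suc n"] that by (simp only: step Suc_le_mono)
  have "half_colour (\<Lambda> ?y') s = half_colour (\<Lambda> ?y) s"
  proof (rule Suc.IH[OF y])
    show "inner s (stripe_dir (\<Lambda> (?y + of_nat N * (3 * s)))) \<noteq> 0"
      using Suc.prems(4) unfolding step .
  qed (rule dirs)
  moreover have "stripe_dir (\<Lambda> ?y') = stripe_dir (\<Lambda> ?y)" using dirs[of 0] by simp
  ultimately have "half_colour (\<Lambda> ?y') (- s) = half_colour (\<Lambda> ?y) s \<longleftrightarrow>
      half_colour (\<Lambda> ?y) (- s) = half_colour (\<Lambda> ?y) s"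
    using half_colour_uminus[OF valid[OF y(1)] s] half_colour_uminus[OF valid[OF y(2)] s] by simp
  hence far_ends: "half_colour (\<Lambda> ?y') (- s) = half_colour (\<Lambda> ?y) (- s)"
    using colour_neq_imp_eq[of "half_colour (\<Lambda> ?y') (- s)" "half_colour (\<Lambda> ?y) s"] by auto
  have "half_colour (\<Lambda> x) s \<noteq> half_colour (\<Lambda> ?y) (- s)" "half_colour (\<Lambda> x') s \<noteq> half_colour (\<Lambda> ?y') (- s)"
    using colour_rule Suc.prems(1,2) s unfolding rule2_def by simp_all
  with far_ends show ?case using colour_neq_imp_eq[of "half_colour (\<Lambda> x') s"] by simp
qed

text \<open>A w-line of finite level does meet a tile whose stripe is not perpendicular to it.  Write \<open>s = 2 * w + d\<close>.
The pairing with \<open>d\<close> is constant along the w-line and not divisible by \<open>2 ^ k\<close>, whereas the pairing with \<open>w\<close>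
grows by \<open>1\<close> with each step \<open>3 * s\<close>, so for some \<open>N\<close> it is divisible by \<open>2 ^ k\<close>.  At this point the pairing with
\<open>s\<close> is not divisible by \<open>2 ^ k\<close>, so that the a-line with normal \<open>s\<close> has smaller level than the one with normal
\<open>w\<close> and does not carry the stripe.\<close>

lemma oblique_stripe_on_w_line:
  assumes s: "s \<in> Omega" and d: "d \<in> a_dirs" "inner s d = 0" and x0: "x0 \<in> Qlat"
    and low: "\<not> line_level_ge q k d x0"
  shows "\<exists>N. \<forall>x\<in>Qcoset k x0. inner s (stripe_dir (\<Lambda> (x + of_nat N * (3 * s)))) \<noteq> 0"
proof -
  define w where "w = (s - d) / 2"
  have w: "w \<in> Omega" unfolding w_def using s d by (rule Omega_half_diff)
  have "2 * w = s - d" unfolding w_def by simp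
  hence sw: "s = 2 * w + d" by simp
  have sn: "s \<in> normals" and wn: "w \<in> normals" and dn: "d \<in> normals"
    using s w d(1) by (simp_all add: normals_def)
  have "inner s w = inner s s / 2"
    using d(2) by (simp add: w_def inner_complex_def) (simp add: field_simps)
  also have "inner s s = 1 / 3" using norm_Omega[OF s] by (simp add: norm_eq_sqrt_inner)
  finally have s3: "2 * inner (3 * s) w = 1" by (simp add: inner_complex_def)
  have s3d: "inner (3 * s) d = 0" using d(2) by (simp add: inner_complex_def)
  obtain v where v: "v \<in> qcomp q k" using qcomp_nonempty by blast
  obtain b where b: "2 * inner (x0 - v) w = of_int b"
    using pairing_integral[OF Qlat_diff[OF x0 qcomp_Qlat[OF v]] wn] by blast
  define N where "N = nat ((- b) mod 2 ^ k)"
  have "int N = (- b) mod 2 ^ k" unfolding N_def by simp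
  hence "(2 ^ k :: int) dvd b + int N" by (simp add: mod_eq_0_iff_dvd [symmetric] mod_add_right_eq)
  then obtain j where j: "b + int N = 2 ^ k * j" by (elim dvdE)
  have inner_N: "inner (of_nat N * (3 * s)) u = real N * inner (3 * s) u" for u
    by (simp add: inner_complex_def algebra_simps)
  define y where "y = x0 + of_nat N * (3 * s)"
  have "2 * inner (y - v) w = 2 * inner (x0 - v) w + real N * (2 * inner (3 * s) w)"
    unfolding y_def by (simp only: inner_N inner_add_left inner_diff_left) (simp add: algebra_simps)
  also have "\<dots> = of_int (b + int N)" using b s3 by simp
  also have "\<dots> = 2 ^ k * of_int j" unfolding j by simp
  finally have yw: "2 * inner (y - v) w = 2 ^ k * of_int j" .
  hence w_high: "line_level_ge q k w y"
    unfolding line_level_ge_iff[OF wn v] pairing_div_def by blast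
  have s_low: "\<not> line_level_ge q k s y"
  proof
    assume "line_level_ge q k s y"
    then obtain i where i: "2 * inner (y - v) s = 2 ^ k * of_int i"
      unfolding line_level_ge_iff[OF sn v] pairing_div_def by blast
    have "inner (y - v) d = inner (x0 - v) d + real N * inner (3 * s) d"
      unfolding y_def by (simp add: inner_N inner_add_left inner_diff_left)
    moreover have "inner (y - v) s = 2 * inner (y - v) w + inner (y - v) d"
      unfolding sw by (simp add: inner_complex_def algebra_simps)
    ultimately have "2 * inner (x0 - v) d = 2 ^ k * of_int (i - 2 * j)"
      using i yw s3d by (simp add: right_diff_distrib)
    hence "line_level_ge q k d x0"
      unfolding line_level_ge_iff[OF dn v] pairing_div_def by blast
    with low show False ..
  qed
  show ?thesis
  proof (intro exI[of _ N] ballI)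
    fix x assume x: "x \<in> Qcoset k x0"
    let ?y = "x + of_nat N * (3 * s)"
    have NQ: "of_nat N * (3 * s) \<in> Qlat" using triple_Omega_Qlat[OF s] by (rule Qlat_of_nat)
    have "x \<in> Qlat" using x x0 by (auto simp: Qcoset_def intro!: Qlat_add Qlat_pow2)
    hence yQ: "?y \<in> Qlat" using NQ by (rule Qlat_add)
    have cong: "?y \<in> Qcoset k y" using x unfolding y_def by (simp add: Qcoset_iff)
    show "inner s (stripe_dir (\<Lambda> ?y)) \<noteq> 0"
      using stripe_dir_not_lower[OF yQ s w, of k] w_high s_low
        line_level_ge_cong[OF wn cong] line_level_ge_cong[OF sn cong] by blast
  qed
qed

end

section \<open>Local constancy of the colour\<close>

text \<open>Extended to the completion by continuity, the linear form \<open>x \<mapsto> 2 * inner x u\<close> takes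
2-adic values.  This is the set of \<open>y\<close> for which it vanishes at \<open>y + z - q\<close>, that is, at which it is divisible by every power of 2.\<close>

definition exceptional :: "qbar \<Rightarrow> complex \<Rightarrow> complex \<Rightarrow> qbar set" where
  "exceptional q u z = {y. \<forall>k. \<exists>x\<in>qcomp y k. line_level_ge q k u (x + z)}"

definition regular_points :: "qbar \<Rightarrow> qbar set" where
  "regular_points q = - (\<Union>u\<in>normals. \<Union>z\<in>Qlat. exceptional q u z)"

lemma qcomp_shift: "x \<in> qcomp y k \<Longrightarrow> x' \<in> qcomp y k \<Longrightarrow> x' + z \<in> Qcoset k (x + z)"
  using qcomp_eq[of x y k] by (simp add: Qcoset_iff)

lemma regular_points_low_levels:
  assumes "y \<in> regular_points q" "z \<in> Qlat"
  shows "\<exists>K. \<forall>x\<in>qcomp y K. \<forall>u\<in>normals. \<not> line_level_ge q K u (x + z)"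
proof -
  have fin: "finite normals" by (simp add: normals_def a_dirs_def Omega_def)
  have "\<exists>k. \<forall>x\<in>qcomp y k. \<not> line_level_ge q k u (x + z)" if "u \<in> normals" for u
  proof -
    have "y \<notin> exceptional q u z" using assms that by (simp add: regular_points_def)
    thus ?thesis by (simp add: exceptional_def)
  qed
  then obtain f where f: "\<And>u x. u \<in> normals \<Longrightarrow> x \<in> qcomp y (f u) \<Longrightarrow> \<not> line_level_ge q (f u) u (x + z)"
    by metis
  define K where "K = Max (f ` normals)"
  have "f u \<le> K" if "u \<in> normals" for u unfolding K_def using fin that by simp
  hence "\<not> line_level_ge q K u (x + z)" if "u \<in> normals" "x \<in> qcomp y K" for u x
    using that f[of u x] line_level_ge_mono[of "f u" K q u "x + z"] qcomp_antimono[of "f u" K y] by blast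
  thus ?thesis by blast
qed

context generic_tiling
begin

lemma star_regular: 
  assumes "x \<in> Qlat" shows "star x \<in> regular_points q"
proof -
  have "star x \<notin> exceptional q u z" if u: "u \<in> normals" and z: "z \<in> Qlat" for u z
  proof -
    obtain k where k: "\<not> line_level_ge q k u (x + z)"
      using generic_imp_level_bounded[OF generic Qlat_add[OF assms z] u] by blast
    have "\<not> line_level_ge q k u (x' + z)" if x': "x' \<in> qcomp (star x) k" for x'
    proof -
      have "x \<in> qcomp (star x) k" by (simp add: qcomp_star[OF assms])
      thus ?thesis using k line_level_ge_cong[OF u qcomp_shift[OF _ x']] by blast
    qed
    thus ?thesis unfolding exceptional_def by blast
  qed
  thus ?thesis unfolding regular_points_def by blast
qed

text \<open>The colour at \<open>x\<close> is read off from finitely many stripe directions along a w-line through \<open>x\<close> together with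
the side of the stripe at \<open>x\<close>.  Near a regular point each of these data depends on \<open>x\<close> modulo a power of 2
only, and \<open>K\<close> is the largest exponent that occurs.\<close>

lemma colour_locally_constant:
  assumes y: "y \<in> regular_points q"
  shows "\<exists>K. \<forall>x\<in>qcomp y K. \<forall>x'\<in>qcomp y K. colour_at \<Lambda> x' = colour_at \<Lambda> x"
proof -
  have "\<exists>K. \<forall>x\<in>qcomp y K. \<forall>u\<in>normals. \<not> line_level_ge q K u (x + z)" if "z \<in> Qlat" for z
    using regular_points_low_levels[OF y that] .
  then obtain h where h: "\<And>z x u. z \<in> Qlat \<Longrightarrow> x \<in> qcomp y (h z) \<Longrightarrow> u \<in> normals \<Longrightarrow>
      \<not> line_level_ge q (h z) u (x + z)"
    by metis
  obtain x0 where x0: "x0 \<in> qcomp y (h 0)" using qcomp_nonempty by blast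
  note x0Q = qcomp_Qlat[OF x0]
  define s where "s = stripe_side (\<Lambda> x0)"
  define d where "d = stripe_dir (\<Lambda> x0)"
  have s: "s \<in> Omega" unfolding s_def using x0Q by (rule stripe_side_in)
  have d: "d \<in> a_dirs" "inner s d = 0"
    unfolding s_def d_def using stripe_dir_in stripe_side_perp x0Q by auto
  have low0: "\<not> line_level_ge q (h 0) u x0" if "u \<in> normals" for u
    using h[OF Qlat_0 x0 that] by simp
  have side: "stripe_side (\<Lambda> x) = s" if "x \<in> qcomp y (h 0)" for x
    unfolding s_def
  proof (rule stripe_side_cong[OF x0Q qcomp_Qlat[OF that]])
    show "x \<in> Qcoset (h 0) x0" using qcomp_shift[OF x0 that, of 0] by simp
  qed (simp add: low0 normals_def)
  obtain N where N: "\<And>x. x \<in> Qcoset (h 0) x0 \<Longrightarrow> inner s (stripe_dir (\<Lambda> (x + of_nat N * (3 * s)))) \<noteq> 0"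
    using oblique_stripe_on_w_line[OF s d x0Q low0] d(1) unfolding normals_def by blast
  have zQ: "of_nat n * (3 * s) \<in> Qlat" for n
    using triple_Omega_Qlat[OF s] by (rule Qlat_of_nat)
  define K where "K = Max (insert (h 0) ((\<lambda>n. h (of_nat n * (3 * s))) ` {..N}))"
  have K: "h 0 \<le> K" "\<And>n. n \<le> N \<Longrightarrow> h (of_nat n * (3 * s)) \<le> K"
    unfolding K_def by (rule Max_ge; simp)+
  have "colour_at \<Lambda> x' = colour_at \<Lambda> x" if x: "x \<in> qcomp y K" and x': "x' \<in> qcomp y K" for x x'
  proof -
    note xQ = qcomp_Qlat[OF x] and xQ' = qcomp_Qlat[OF x']
    have x_h: "x \<in> qcomp y (h 0)" "x' \<in> qcomp y (h 0)" using x x' qcomp_antimono[OF K(1)] by blast+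
    have "half_colour (\<Lambda> x') s = half_colour (\<Lambda> x) s"
    proof (rule half_colour_propagates[OF s xQ xQ'])
      fix n assume "n \<le> N"
      let ?z = "of_nat n * (3 * s)"
      have x_n: "x \<in> qcomp y (h ?z)" "x' \<in> qcomp y (h ?z)"
        using x x' qcomp_antimono[OF K(2)[OF \<open>n \<le> N\<close>]] by blast+
      show "stripe_dir (\<Lambda> (x' + ?z)) = stripe_dir (\<Lambda> (x + ?z))"
      proof (rule stripe_dir_cong)
        show "x' + ?z \<in> Qcoset (h ?z) (x + ?z)" using x_n by (rule qcomp_shift)
        show "\<not> line_level_ge q (h ?z) w (x + ?z)" if "w \<in> Omega" for w
          using h[OF zQ x_n(1)] that by (simp add: normals_def)
      qed (use xQ xQ' zQ in \<open>simp_all only: Qlat_add\<close>)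
    next
      show "inner s (stripe_dir (\<Lambda> (x + of_nat N * (3 * s)))) \<noteq> 0"
        using N qcomp_shift[OF x0 x_h(1), of 0] by simp
    qed
    thus ?thesis using side x_h by (simp add: colour_at_def)
  qed
  thus ?thesis by blast
qed

end

section \<open>The completion as a topological space\<close>

lemma star_in_qcyl_iff: "x \<in> Qlat \<Longrightarrow> star x \<in> qcyl k y \<longleftrightarrow> x \<in> qcomp y k"
  by (metis (mono_tags, lifting) Qcoset_self mem_Collect_eq qcomp_eq qcomp_star qcyl_def)

lemma clopen_qcyl: "open (qcyl k y)" "closed (qcyl k y)"
proof -
  have "open (- qcyl k y)"
    unfolding open_qbar_def qcyl_def by auto
  thus "closed (qcyl k y)" by (simp add: closed_def)
qed (rule open_qcyl)

lemma qcomp_doubling: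
  "qcomp y j = Qcoset j v \<Longrightarrow> qcomp (((\<lambda>z. z + z) ^^ k) y) j = Qcoset j (2 ^ k * v)"
proof (induction k)
  case (Suc k)
  thus ?case using qcomp_plus[of "((\<lambda>z. z + z) ^^ k) y" j "2 ^ k * v" "((\<lambda>z. z + z) ^^ k) y" "2 ^ k * v"]
    by (simp add: algebra_simps)
qed simp

lemma Qcoset_scale: "2 ^ k * u \<in> Qcoset (j + k) (2 ^ k * v) \<longleftrightarrow> u \<in> Qcoset j v"
proof -
  have "2 ^ k * u - 2 ^ k * v = 2 ^ (j + k) * z \<longleftrightarrow> u - v = 2 ^ j * z" for z
  proof -
    have "2 ^ k * u - 2 ^ k * v = 2 ^ k * (u - v)" "2 ^ (j + k) * z = 2 ^ k * (2 ^ j * z)"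
      by (simp_all add: algebra_simps power_add)
    hence "2 ^ k * u - 2 ^ k * v = 2 ^ (j + k) * z \<longleftrightarrow> 2 ^ k * (u - v) = 2 ^ k * (2 ^ j * z)"
      by (simp only:)
    thus ?thesis by simp
  qed
  thus ?thesis by (simp add: Qcoset_iff)
qed

text \<open>An element of the completion that vanishes modulo \<open>2\<^sup>k Q\<close> is halved \<open>k\<close> times by halving all its components
and shifting the index by \<open>k\<close>.\<close>

lemma doubling_surj:
  assumes "qcomp z k = Qcoset k 0"
  shows "\<exists>y. ((\<lambda>z. z + z) ^^ k) y = z"
proof -
  have ex: "\<exists>v\<in>Qlat. qcomp z (j + k) = Qcoset (j + k) (2 ^ k * v)" for j
  proof -
    obtain u where u: "u \<in> Qlat" "qcomp z (j + k) = Qcoset (j + k) u" using qcomp_ex by blast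
    hence "u \<in> qcomp z (j + k)" by simp
    hence "u \<in> Qcoset k 0" using qcomp_antimono[of k "j + k" z] assms by auto
    then obtain v where "v \<in> Qlat" "u = 2 ^ k * v" by (auto simp: Qcoset_def)
    with u show ?thesis by blast
  qed
  define c where "c j = {u. 2 ^ k * u \<in> qcomp z (j + k)}" for j
  have c: "c j = Qcoset j v" if "qcomp z (j + k) = Qcoset (j + k) (2 ^ k * v)" for j v
    unfolding c_def that Qcoset_scale by simp
  have "compatible c"
    unfolding compatible_def
  proof (intro conjI allI)
    show "\<exists>v\<in>Qlat. c j = Qcoset j v" for j using ex[of j] c by blast
    show "c (Suc j) \<subseteq> c j" for j unfolding c_def using qcomp_Suc[of z "j + k"] by auto
  qed
  hence qc: "qcomp (Abs_qbar c) = c" by (simp add: Abs_qbar_inverse)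
  have "((\<lambda>z. z + z) ^^ k) (Abs_qbar c) = z"
  proof (rule qbar_eqI)
    fix j
    obtain v where v: "v \<in> Qlat" "qcomp z (j + k) = Qcoset (j + k) (2 ^ k * v)" using ex by blast
    have "qcomp (Abs_qbar c) j = Qcoset j v" unfolding qc using c[OF v(2)] .
    hence "qcomp (((\<lambda>z. z + z) ^^ k) (Abs_qbar c)) j = Qcoset j (2 ^ k * v)" by (rule qcomp_doubling)
    moreover have "2 ^ k * v \<in> qcomp z j"
      using v(2) Qcoset_self qcomp_antimono[of j "j + k" z] by auto
    ultimately show "qcomp (((\<lambda>z. z + z) ^^ k) (Abs_qbar c)) j = qcomp z j"
      using qcomp_eq by metis
  qed
  thus ?thesis ..
qed

lemma basic_clopen_eq_qcyl:
  assumes "x \<in> Qlat" shows "basic_clopen x k = qcyl k (star x)"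
proof (intro equalityI subsetI)
  fix z assume "z \<in> basic_clopen x k"
  then obtain y where y: "z = star x + ((\<lambda>z. z + z) ^^ k) y" by (auto simp: basic_clopen_def)
  obtain v where v: "v \<in> Qlat" "qcomp y k = Qcoset k v" using qcomp_ex by blast
  have "qcomp z k = Qcoset k (x + 2 ^ k * v)"
    unfolding y using qcomp_plus[OF qcomp_star[OF assms] qcomp_doubling[OF v(2)]] .
  also have "\<dots> = Qcoset k x" unfolding Qcoset_eq_iff Qcoset_iff using v(1) by simp
  finally show "z \<in> qcyl k (star x)" by (simp add: qcyl_def qcomp_star[OF assms])
next
  fix z assume "z \<in> qcyl k (star x)"
  hence "qcomp z k = Qcoset k x" by (simp add: qcyl_def qcomp_star[OF assms])
  hence "qcomp (- star x + z) k = Qcoset k (- x + x)"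
    by (intro qcomp_plus qcomp_uminus qcomp_star assms)
  hence "qcomp (- star x + z) k = Qcoset k 0" by simp
  then obtain y where "((\<lambda>z. z + z) ^^ k) y = - star x + z" using doubling_surj by blast
  hence "z = star x + ((\<lambda>z. z + z) ^^ k) y" by (simp add: algebra_simps)
  thus "z \<in> basic_clopen x k" unfolding basic_clopen_def by blast
qed

text \<open>The digit expansion is a continuous map from the Cantor space \<open>nat \<Rightarrow> bool \<times> bool\<close>; its image is compact, hence
closed, and it meets every cylinder.\<close>

lemma compact_qbar: "compact (UNIV :: qbar set)"
proof -
  have "compact (UNIV :: (nat \<Rightarrow> bool \<times> bool) set)"
  proof -
    have "compact_space (euclidean :: (bool \<times> bool) topology)"
      by (simp add: compact_space_def finite_imp_compact)
    hence "compact_space (product_topology (\<lambda>_. euclidean) UNIV :: (nat \<Rightarrow> bool \<times> bool) topology)"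
      by (simp add: compact_space_product_topology)
    thus ?thesis by (simp add: euclidean_product_topology compact_space_def)
  qed
  moreover have "continuous_on UNIV of_digits"
  proof (rule continuous_on_open_vimage[THEN iffD2, rule_format, OF open_UNIV])
    fix U :: "qbar set" assume U: "open U"
    have "open (of_digits -` U)"
    proof (rule topological_space_class.openI)
      fix d assume "d \<in> of_digits -` U"
      hence "of_digits d \<in> U" by simp
      from open_qbarD[OF U this] obtain k where k: "qcyl k (of_digits d) \<subseteq> U"
        unfolding qcyl_def by (rule exE)
      obtain e where e: "of_digits -` qcyl k (of_digits d) = {d. \<forall>i\<in>{..<k}. d i \<in> {e i}}"
        using of_digits_vimage by blast
      have INT: "of_digits -` qcyl k (of_digits d) = (\<Inter>i\<in>{..<k}. (\<lambda>d. d i) -` {e i})"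
        unfolding e by auto
      have proj: "open ((\<lambda>d. d i) -` {e i})" for i
      proof (rule open_vimage)
        have "closed (- {e i})" by (rule finite_imp_closed) simp
        thus "open {e i}" by (simp add: closed_def)
      qed simp
      have "open (of_digits -` qcyl k (of_digits d))"
        unfolding INT using proj by (intro open_INT ballI) auto
      moreover have "d \<in> of_digits -` qcyl k (of_digits d)" by (simp add: qcyl_self)
      moreover have "of_digits -` qcyl k (of_digits d) \<subseteq> of_digits -` U" using k by blast
      ultimately show "\<exists>T. open T \<and> d \<in> T \<and> T \<subseteq> of_digits -` U" by blast
    qed
    thus "open (of_digits -` U \<inter> UNIV)" by simp
  qed
  ultimately have comp: "compact (range of_digits)" by (rule compact_continuous_image[rotated])
  have "closure (range of_digits) = UNIV"
  proof (intro equalityI subsetI)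
    fix y
    show "y \<in> closure (range of_digits)"
      unfolding closure_iff_nhds_not_empty
    proof (intro allI impI)
      fix A V :: "qbar set" assume "V \<subseteq> A" "open V" "y \<in> V"
      from open_qbarD[OF this(2,3)] obtain k where k: "qcyl k y \<subseteq> V"
        unfolding qcyl_def by (rule exE)
      obtain e where "of_digits -` qcyl k y = {d. \<forall>i\<in>{..<k}. d i \<in> {e i}}"
        using of_digits_vimage by blast
      hence "of_digits e \<in> qcyl k y" by auto
      thus "range of_digits \<inter> A \<noteq> {}" using k \<open>V \<subseteq> A\<close> by blast
    qed
  qed simp
  hence "range of_digits = UNIV" using compact_imp_closed[OF comp] by simp
  with comp show ?thesis by simp
qed

section \<open>Exceptional points have measure zero\<close>

lemma prob_space_haar: "prob_space haar"
proof
  have "sets haar = sets borel" "emeasure haar UNIV = 1"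
    using is_haar_haar by (simp_all add: is_haar_def)
  moreover from this(1) have "space haar = UNIV" by (metis sets_eq_imp_space_eq space_borel)
  ultimately show "emeasure haar (space haar) = 1" by simp
qed

lemma closed_exceptional: "closed (exceptional q u z)"
proof -
  have "open (- exceptional q u z)"
    unfolding open_qbar_def
  proof
    fix y assume "y \<in> - exceptional q u z"
    then obtain k where k: "\<not> (\<exists>x\<in>qcomp y k. line_level_ge q k u (x + z))"
      unfolding exceptional_def by blast
    have "y' \<notin> exceptional q u z" if "qcomp y' k = qcomp y k" for y'
      using k unfolding that [symmetric] exceptional_def by blast
    hence "{y'. qcomp y' k = qcomp y k} \<subseteq> - exceptional q u z" by blast
    thus "\<exists>k. {y'. qcomp y' k = qcomp y k} \<subseteq> - exceptional q u z" ..
  qed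
  thus ?thesis by (simp add: closed_def)
qed

text \<open>Moving an exceptional point by \<open>i * c\<close> changes the relevant pairing, which is infinitely divisible by 2,
by the integer \<open>i\<close>.  Two translates can meet only if \<open>i - j\<close> is divisible by every power of 2.\<close>

lemma exceptional_translates_disjoint:
  fixes i j :: nat
  assumes "u \<in> normals" "c \<in> Qlat" "2 * inner c u = 1" "i \<noteq> j"
  shows "(+) (star (of_nat i * c)) ` exceptional q u z \<inter> (+) (star (of_nat j * c)) ` exceptional q u z = {}"
proof -
  have False
    if y: "y1 \<in> exceptional q u z" "y2 \<in> exceptional q u z"
      "star (of_nat i * c) + y1 = star (of_nat j * c) + y2" for y1 y2
  proof -
    have dvd: "(2 :: int) ^ k dvd int i - int j" for k
    proof -
      obtain x1 x2 where x: "x1 \<in> qcomp y1 k" "line_level_ge q k u (x1 + z)"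
        "x2 \<in> qcomp y2 k" "line_level_ge q k u (x2 + z)"
        using y(1,2) unfolding exceptional_def by blast
      obtain v where v: "v \<in> qcomp q k" using qcomp_nonempty by blast
      have "pairing_div k u ((x2 + z - v) - (x1 + z - v))"
        using x(2,4) unfolding line_level_ge_iff[OF assms(1) v] by (rule pairing_div_diff[rotated])
      hence d: "pairing_div k u (x2 - x1)" by simp
      have "Qcoset k (of_nat i * c + x1) = Qcoset k (of_nat j * c + x2)"
        using qcomp_plus[OF qcomp_star[OF Qlat_of_nat[OF assms(2)]] qcomp_eq[OF x(1)], of i]
          qcomp_plus[OF qcomp_star[OF Qlat_of_nat[OF assms(2)]] qcomp_eq[OF x(3)], of j] y(3)
        by simp
      then obtain w where w: "w \<in> Qlat" "of_nat i * c + x1 - (of_nat j * c + x2) = 2 ^ k * w"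
        unfolding Qcoset_eq_iff Qcoset_iff by blast
      have "of_int (int i - int j) * c = (x2 - x1) + 2 ^ k * w"
        unfolding w(2)[symmetric] by (simp add: algebra_simps)
      hence "pairing_div k u (of_int (int i - int j) * c)"
        using pairing_div_add[OF d pairing_div_pow2[OF assms(1) w(1), of k]] by simp
      then obtain m :: int where "2 * inner (of_int (int i - int j) * c) u = 2 ^ k * of_int m"
        unfolding pairing_div_def by blast
      moreover have "2 * inner (of_int (int i - int j) * c) u = of_int (int i - int j) * (2 * inner c u)"
        by (simp add: inner_complex_def algebra_simps)
      ultimately have "real_of_int (int i - int j) = real_of_int (2 ^ k * m)"
        unfolding assms(3) by simp
      hence "int i - int j = 2 ^ k * m" by (rule of_int_eq_iff[THEN iffD1])
      thus ?thesis by simp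
    qed
    define k where "k = nat \<bar>int i - int j\<bar>"
    have "\<bar>int i - int j\<bar> < 2 ^ k"
      using of_nat_less_two_power[of k, where 'a = int] by (simp add: k_def)
    with dvd[of k] assms(4) show False using zdvd_imp_le[of "2 ^ k" "\<bar>int i - int j\<bar>"] by simp
  qed
  thus ?thesis by blast
qed

lemma open_translation_qbar:
  fixes g :: qbar
  assumes "open U" shows "open ((+) g ` U)"
  unfolding open_qbar_def
proof
  fix z assume "z \<in> (+) g ` U"
  then obtain y where y: "y \<in> U" "z = g + y" by blast
  from open_qbarD[OF assms y(1)] obtain k where "qcyl k y \<subseteq> U" unfolding qcyl_def by (rule exE)
  hence "qcyl k z \<subseteq> (+) g ` U" using translate_qcyl[of g k y] y(2) by blast
  thus "\<exists>k. {x. qcomp x k = qcomp z k} \<subseteq> (+) g ` U" unfolding qcyl_def ..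
qed

lemma closed_translation_qbar:
  fixes g :: qbar
  assumes "closed S" shows "closed ((+) g ` S)"
proof -
  have "- (+) g ` S = (+) g ` (- S)"
    by (rule bij_image_Compl_eq [symmetric]) simp
  thus ?thesis using open_translation_qbar[of "- S" g] assms by (simp add: closed_def)
qed

text \<open>A set of positive Haar measure cannot have infinitely many disjoint translates.\<close>

lemma haar_exceptional:
  assumes "u \<in> normals"
  shows "exceptional q u z \<in> null_sets haar"
proof -
  interpret prob_space haar by (rule prob_space_haar)
  have sets: "sets haar = sets borel" using is_haar_haar by (simp add: is_haar_def)
  let ?E = "exceptional q u z"
  have E: "?E \<in> sets borel" using closed_exceptional by (rule borel_closed)
  obtain c where c: "c \<in> Qlat" "2 * inner c u = 1" using pairing_surj[OF assms, of 1] by auto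
  define T where "T i = (+) (star (of_nat i * c)) ` ?E" for i :: nat
  have em: "emeasure haar (T i) = emeasure haar ?E" for i
    using is_haar_haar E by (simp add: is_haar_def T_def)
  have T: "T i \<in> sets haar" for i
    unfolding sets T_def using closed_exceptional by (intro borel_closed closed_translation_qbar)
  have disj: "disjoint_family T"
    unfolding disjoint_family_on_def T_def using exceptional_translates_disjoint[OF assms c] by blast
  have "real n * measure haar ?E \<le> 1" for n
  proof -
    have "measure haar (\<Union>i\<in>{..<n}. T i) = (\<Sum>i\<in>{..<n}. measure haar (T i))"
      using T disj by (intro finite_measure_finite_Union) (auto simp: disjoint_family_on_def)
    also have "\<dots> = real n * measure haar ?E" using em by (simp add: measure_def)
    finally show ?thesis using prob_le_1[of "\<Union>i\<in>{..<n}. T i"] by simp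
  qed
  hence "measure haar ?E = 0"
    using reals_Archimedean3[of "measure haar ?E"] by (metis linorder_not_less zero_less_measure_iff)
  thus ?thesis using E sets by (simp add: null_sets_def emeasure_eq_measure)
qed

lemma haar_regular_points: "- regular_points q \<in> null_sets haar"
proof -
  have "(\<Union>(u, z)\<in>normals \<times> Qlat. exceptional q u z) \<in> null_sets haar"
  proof (rule null_sets_UN')
    have "finite normals" by (simp add: normals_def a_dirs_def Omega_def)
    thus "countable (normals \<times> Qlat)" using countable_Qlat by (intro countable_SIGMA) (auto intro: countable_finite)
  qed (auto intro: haar_exceptional)
  moreover have "- regular_points q = (\<Union>(u, z)\<in>normals \<times> Qlat. exceptional q u z)"
    unfolding regular_points_def by auto
  ultimately show ?thesis by simp
qed

section \<open>Model sets from locally constant colourings\<close>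

definition locally_constant_at :: "(complex \<Rightarrow> 'c) \<Rightarrow> qbar \<Rightarrow> bool" where
  "locally_constant_at f y \<longleftrightarrow> (\<exists>K. \<forall>x\<in>qcomp y K. \<forall>x'\<in>qcomp y K. f x' = f x)"

text \<open>The open set of points of the completion near which the colouring \<open>f\<close> of the lattice has the constant
value \<open>c\<close>; the lattice points of colour \<open>c\<close> are dense in it.\<close>

definition region :: "(complex \<Rightarrow> 'c) \<Rightarrow> 'c \<Rightarrow> qbar set" where
  "region f c = {y. \<exists>K. \<forall>x\<in>qcomp y K. f x = c}"

lemma region_qcyl:
  assumes "y \<in> region f c" shows "\<exists>K. qcyl K y \<subseteq> region f c"
proof -
  obtain K where K: "\<forall>x\<in>qcomp y K. f x = c" using assms unfolding region_def by blast
  have "qcyl K y \<subseteq> region f c"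
  proof
    fix z assume "z \<in> qcyl K y"
    hence "qcomp z K = qcomp y K" by (simp add: qcyl_def)
    hence "\<forall>x\<in>qcomp z K. f x = c" using K by simp
    thus "z \<in> region f c" unfolding region_def by blast
  qed
  thus ?thesis ..
qed

lemma open_region: "open (region f c)"
  unfolding open_qbar_def
proof
  fix y assume "y \<in> region f c"
  thus "\<exists>k. {z. qcomp z k = qcomp y k} \<subseteq> region f c" using region_qcyl unfolding qcyl_def by metis
qed

lemma star_region_imp: "x \<in> Qlat \<Longrightarrow> star x \<in> region f c \<Longrightarrow> f x = c"
  unfolding region_def by (auto simp: qcomp_star)

lemma locally_constant_at_region:
  assumes "locally_constant_at f y" shows "\<exists>c. y \<in> region f c"
  using assms qcomp_nonempty unfolding locally_constant_at_def region_def by blast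

lemma star_in_region:
  assumes "locally_constant_at f (star x)" "x \<in> Qlat"
  shows "star x \<in> region f (f x)"
proof -
  obtain c where c: "star x \<in> region f c" using locally_constant_at_region[OF assms(1)] ..
  with star_region_imp[OF assms(2) this] show ?thesis by simp
qed

lemma region_subset_closure: "region f c \<subseteq> closure (star ` {x \<in> Qlat. f x = c})"
proof
  fix y assume "y \<in> region f c"
  then obtain K where K: "\<And>x. x \<in> qcomp y K \<Longrightarrow> f x = c" unfolding region_def by blast
  show "y \<in> closure (star ` {x \<in> Qlat. f x = c})"
    unfolding closure_iff_nhds_not_empty
  proof (intro allI impI)
    fix A V :: "qbar set" assume "V \<subseteq> A" "open V" "y \<in> V"
    from open_qbarD[OF this(2,3)] obtain k where k: "qcyl k y \<subseteq> V"
      unfolding qcyl_def by (rule exE)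
    obtain x where x: "x \<in> qcomp y (max k K)" using qcomp_nonempty by blast
    hence xk: "x \<in> qcomp y k" and xK: "x \<in> qcomp y K"
      using qcomp_antimono[of k "max k K" y] qcomp_antimono[of K "max k K" y] by auto
    have xQ: "x \<in> Qlat" using x by (rule qcomp_Qlat)
    have "star x \<in> V" using k xk star_in_qcyl_iff[OF xQ] by blast
    thus "star ` {x \<in> Qlat. f x = c} \<inter> A \<noteq> {}" using xQ K[OF xK] \<open>V \<subseteq> A\<close> by blast
  qed
qed

text \<open>The region of another colour is an open set free of lattice points of colour \<open>c\<close>.  This is why taking the closure
adds no lattice points and why the boundary avoids every point of local constancy.\<close>

lemma closure_disjoint_region:
  assumes "c' \<noteq> c" shows "closure (star ` {x \<in> Qlat. f x = c}) \<inter> region f c' = {}"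
proof -
  have "star ` {x \<in> Qlat. f x = c} \<inter> region f c' = {}"
    using assms star_region_imp by fastforce
  thus ?thesis using open_Int_closure_eq_empty[OF open_region] by (metis Int_commute)
qed

lemma closure_eq_closure_region:
  assumes "\<And>x. x \<in> Qlat \<Longrightarrow> locally_constant_at f (star x)"
  shows "closure (star ` {x \<in> Qlat. f x = c}) = closure (region f c)"
proof
  have "star ` {x \<in> Qlat. f x = c} \<subseteq> region f c" using star_in_region assms by blast
  thus "closure (star ` {x \<in> Qlat. f x = c}) \<subseteq> closure (region f c)" by (rule closure_mono)
  show "closure (region f c) \<subseteq> closure (star ` {x \<in> Qlat. f x = c})"
    using region_subset_closure by (rule closure_minimal) simp
qed

lemma region_Union_clopen:
  "\<exists>\<B>. (\<forall>B\<in>\<B>. open B \<and> closed B \<and> (\<exists>x\<in>Qlat. \<exists>k. B = basic_clopen x k)) \<and> region f c = \<Union>\<B>"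
proof -
  let ?B = "{B. B \<subseteq> region f c \<and> (\<exists>x\<in>Qlat. \<exists>k. B = basic_clopen x k)}"
  have "region f c \<subseteq> \<Union>?B"
  proof
    fix y assume y: "y \<in> region f c"
    obtain K where K: "qcyl K y \<subseteq> region f c" using region_qcyl[OF y] ..
    obtain x where x: "x \<in> Qlat" "qcyl K y = qcyl K (star x)" using qcyl_star ..
    have "qcyl K y = basic_clopen x K" using basic_clopen_eq_qcyl[OF x(1)] x(2) by simp
    hence "qcyl K y \<in> ?B" using K x(1) by (intro CollectI conjI bexI exI)
    thus "y \<in> \<Union>?B" using qcyl_self by (rule UnionI)
  qed
  moreover have "\<Union>?B \<subseteq> region f c" by (rule Union_least) simp
  moreover have "\<forall>B\<in>?B. open B \<and> closed B \<and> (\<exists>x\<in>Qlat. \<exists>k. B = basic_clopen x k)"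
  proof
    fix B assume "B \<in> ?B"
    hence ex: "\<exists>x\<in>Qlat. \<exists>k. B = basic_clopen x k" by simp
    then obtain x k where "x \<in> Qlat" "B = basic_clopen x k" by (elim bexE exE)
    hence "B = qcyl k (star x)" by (simp add: basic_clopen_eq_qcyl)
    with ex show "open B \<and> closed B \<and> (\<exists>x\<in>Qlat. \<exists>k. B = basic_clopen x k)"
      by (simp only: clopen_qcyl simp_thms)
  qed
  ultimately show ?thesis by (intro exI[of _ ?B] conjI equalityI)
qed

lemma curlywedge_closure:
  assumes "\<And>x. x \<in> Qlat \<Longrightarrow> locally_constant_at f (star x)"
  shows "curlywedge (closure (star ` {x \<in> Qlat. f x = c})) = {x \<in> Qlat. f x = c}"
proof (intro equalityI subsetI)
  fix x assume "x \<in> curlywedge (closure (star ` {x \<in> Qlat. f x = c}))"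
  hence x: "x \<in> Qlat" "star x \<in> closure (star ` {x \<in> Qlat. f x = c})" by (simp_all add: curlywedge_def)
  have "star x \<in> region f (f x)" using assms[OF x(1)] x(1) by (rule star_in_region)
  hence "f x = c" using closure_disjoint_region[of "f x" c f] x(2) by (metis IntI empty_iff)
  with x(1) show "x \<in> {x \<in> Qlat. f x = c}" by simp
next
  fix x assume x: "x \<in> {x \<in> Qlat. f x = c}"
  hence "star x \<in> closure (star ` {x \<in> Qlat. f x = c})"
    by (intro subsetD[OF closure_subset] imageI)
  with x show "x \<in> curlywedge (closure (star ` {x \<in> Qlat. f x = c}))" by (simp add: curlywedge_def)
qed

text \<open>Every colour class of a colouring that is locally constant at all lattice points and at almost all points of
the completion is a regular model set: its window is the closure of \<open>region f c\<close>, and a boundary point of the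
window cannot be a point of local constancy.\<close>

lemma regular_model_set:
  assumes loc: "\<And>x. x \<in> Qlat \<Longrightarrow> locally_constant_at f (star x)"
    and null: "N \<in> null_sets haar" "\<And>y. y \<notin> N \<Longrightarrow> locally_constant_at f y"
  shows "is_regular_model_set {x \<in> Qlat. f x = c} (closure (star ` {x \<in> Qlat. f x = c}))"
proof -
  let ?W = "closure (star ` {x \<in> Qlat. f x = c})"
  have reg: "region f c \<subseteq> interior ?W"
    using region_subset_closure open_region by (rule interior_maximal)
  have dense: "?W \<subseteq> closure (interior ?W)"
    using closure_mono[OF reg] closure_eq_closure_region[of f c] loc by simp
  have "closure (interior ?W) \<subseteq> closure ?W" by (intro closure_mono interior_subset)
  hence eq: "closure (interior ?W) = closure ?W" using dense by simp
  have "closed (closure ?W)" by simp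
  hence comp: "compact (closure ?W)" using compact_Int_closed[OF compact_qbar] by fastforce
  have "is_model_set {x \<in> Qlat. f x = c} ?W"
    unfolding is_model_set_def using curlywedge_closure[OF loc] interior_subset dense eq comp by blast
  moreover have "closure ?W - interior ?W \<subseteq> N"
  proof
    fix y assume y: "y \<in> closure ?W - interior ?W"
    show "y \<in> N"
    proof (rule ccontr)
      assume "y \<notin> N"
      then obtain c' where c': "y \<in> region f c'" using null(2) locally_constant_at_region by blast
      have "y \<in> ?W" "y \<notin> interior ?W" using y by auto
      thus False using c' closure_disjoint_region[of c' c f] reg by blast
    qed
  qed
  hence "emeasure haar (closure ?W - interior ?W) = 0"
  proof -
    have sets: "sets haar = sets borel" using is_haar_haar by (simp add: is_haar_def)
    have "closure ?W - interior ?W \<in> sets haar" unfolding sets by (intro sets.Diff borel_closed borel_open) auto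
    thus ?thesis using null_sets_subset[OF null(1)] \<open>closure ?W - interior ?W \<subseteq> N\<close> by blast
  qed
  ultimately show ?thesis unfolding is_regular_model_set_def by blast
qed

theorem theorem7p1:
  fixes \<epsilon> :: real and \<Lambda> :: tiling and q :: qbar
  assumes "0 < \<epsilon>" and "\<epsilon> \<le> 1 / 4"
    and "\<Lambda> \<in> X_Q \<epsilon>"
    and "is_xi \<Lambda> q"
    and "generic q"
  shows "(\<exists>\<B>. (\<forall>B\<in>\<B>. open B \<and> closed B \<and> (\<exists>x\<in>Qlat. \<exists>k. B = basic_clopen x k)) \<and>
            closure (star ` Q_wh \<epsilon> \<Lambda>) = closure (\<Union>\<B>)) \<and>
         (\<exists>\<B>. (\<forall>B\<in>\<B>. open B \<and> closed B \<and> (\<exists>x\<in>Qlat. \<exists>k. B = basic_clopen x k)) \<and>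
            closure (star ` Q_gr \<epsilon> \<Lambda>) = closure (\<Union>\<B>)) \<and>
         Q_wh \<epsilon> \<Lambda> = curlywedge (closure (star ` Q_wh \<epsilon> \<Lambda>)) \<and>
         Q_gr \<epsilon> \<Lambda> = curlywedge (closure (star ` Q_gr \<epsilon> \<Lambda>)) \<and>
         Qlat = curlywedge (closure (star ` Q_wh \<epsilon> \<Lambda>)) \<union> curlywedge (closure (star ` Q_gr \<epsilon> \<Lambda>)) \<and>
         is_regular_model_set (Q_wh \<epsilon> \<Lambda>) (closure (star ` Q_wh \<epsilon> \<Lambda>)) \<and>
         is_regular_model_set (Q_gr \<epsilon> \<Lambda>) (closure (star ` Q_gr \<epsilon> \<Lambda>))"
proof -
  have valid: "valid_tile (\<Lambda> x)" if "x \<in> Qlat" for x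
    using assms(3) that by (simp add: X_Q_def)
  interpret generic_tiling \<Lambda> q
    using assms(3-5) valid by unfold_locales (simp_all add: X_Q_def)
  let ?f = "colour_at \<Lambda>"
  have Q: "Q_wh \<epsilon> \<Lambda> = {x \<in> Qlat. ?f x = Red}" "Q_gr \<epsilon> \<Lambda> = {x \<in> Qlat. ?f x = Blue}"
    unfolding Q_wh_def Q_gr_def colour_at_def
    using stripe_crosses_iff[OF valid assms(1,2)] by auto
  have loc: "locally_constant_at ?f y" if "y \<in> regular_points q" for y
    unfolding locally_constant_at_def using that by (rule colour_locally_constant)
  have loc_star: "locally_constant_at ?f (star x)" if "x \<in> Qlat" for x
    using loc star_regular[OF that] .
  have union: "\<exists>\<B>. (\<forall>B\<in>\<B>. open B \<and> closed B \<and> (\<exists>x\<in>Qlat. \<exists>k. B = basic_clopen x k)) \<and>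
      closure (star ` {x \<in> Qlat. ?f x = c}) = closure (\<Union>\<B>)" for c
    using region_Union_clopen[of ?f c] closure_eq_closure_region[of ?f, OF loc_star, of c]
    by (elim ex_forward conjE) simp
  have wedge: "curlywedge (closure (star ` {x \<in> Qlat. ?f x = c})) = {x \<in> Qlat. ?f x = c}" for c
    using loc_star by (rule curlywedge_closure)
  have model: "is_regular_model_set {x \<in> Qlat. ?f x = c} (closure (star ` {x \<in> Qlat. ?f x = c}))" for c
    using loc_star haar_regular_points loc by (rule regular_model_set) auto
  have "Qlat = {x \<in> Qlat. ?f x = Red} \<union> {x \<in> Qlat. ?f x = Blue}"
    using colour.exhaust by blast
  thus ?thesis unfolding Q wedge by (intro conjI union model refl)
qed

end
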